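(* Let $G=G_1\ast_A G_2$ be an amalgam of finite groups. There is an algorithm which, given $h_1,\ldots,h_s,k_1,\ldots,k_t\in G$, decides whether or not the subgroups $H=\langle h_1,\ldots,h_s\rangle$ and $K=\langle k_1,\ldots,k_t\rangle$ are conjugate in $G$.
   Context: $G=G_1\ast_A G_2$ is a free product with amalgamation, where $G_1=\langle X_1\mid R_1\rangle$ and $G_2=\langle X_2\mid R_2\rangle$ are finite groups given by finite presentations with $X_1^{\pm}\cap X_2^{\pm}=\emptyset$, $A$ is a group generated by $Y$ with monomorphisms $\phi_i:A\to G_i$ ($i=1,2$), and $G=\langle X_1\cup X_2\mid R_1,R_2,\ \phi_1(a)=\phi_2(a)\ (a\in Y)\rangle$. The amalgam (the finite groups $G_1,G_2,A$, their presentations, the monomorphisms) is fixed and known to the algorithm. Elements of $G$ are input as words in the letters $X^{\pm}$, where $X=X_1\cup X_2$. *)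

theory Defs
  imports "HOL-Algebra.Generated_Groups" "HOL-Library.Nat_Bijection"
begin

section \<open>Partial recursive functions\<close>

datatype recf =
    Zero
  | Succ
  | Proj nat
  | Comp recf "recf list"
  | PrimRec recf recf
  | Minim recf

text \<open>
  \<open>computes p xs y\<close>: the partial recursive function denoted by \<open>p\<close> is defined
  at the argument tuple \<open>xs\<close> and has the value \<open>y\<close> there. The recursion and search
  variables are the first argument; arities are not recorded, and ill-formed applications are
  undefined. Minimization is undefined if some value below the first zero is undefined.
\<close>

inductive computes :: "recf \<Rightarrow> nat list \<Rightarrow> nat \<Rightarrow> bool" where
  Zero: "computes Zero xs 0"
| Succ: "computes Succ [n] (Suc n)"
| Proj: "i < length xs \<Longrightarrow> computes (Proj i) xs (xs ! i)"
| Comp: "list_all2 (\<lambda>g y. computes g xs y) gs ys \<Longrightarrow> computes f ys z \<Longrightarrow>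
    computes (Comp f gs) xs z"
| PrimRec_0: "computes f xs y \<Longrightarrow> computes (PrimRec f g) (0 # xs) y"
| PrimRec_Suc: "computes (PrimRec f g) (n # xs) r \<Longrightarrow> computes g (n # r # xs) y \<Longrightarrow>
    computes (PrimRec f g) (Suc n # xs) y"
| Minim: "computes f (n # xs) 0 \<Longrightarrow> (\<forall>m<n. \<exists>y. computes f (m # xs) (Suc y)) \<Longrightarrow>
    computes (Minim f) xs n"

lemma computes_deterministic:
  "computes p xs y \<Longrightarrow> computes p xs z \<Longrightarrow> y = z"
proof (induction arbitrary: z rule: computes.induct)
  case (Zero xs)
  then show ?case by (cases rule: computes.cases) auto
next
  case (Succ n)
  then show ?case by (cases rule: computes.cases) auto
next
  case (Proj i xs)
  from Proj(2) show ?case by (cases rule: computes.cases) auto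
next
  case (Comp xs gs ys f w)
  from Comp.prems obtain ys' where
    ys': "list_all2 (\<lambda>g y. computes g xs y) gs ys'" and f: "computes f ys' z"
    by (cases rule: computes.cases) blast
  note ys = Comp.IH(1)[unfolded list_all2_conv_all_nth]
  note ys' = ys'[unfolded list_all2_conv_all_nth]
  have len: "length gs = length ys" "length gs = length ys'"
    by (rule conjunct1[OF ys], rule conjunct1[OF ys'])
  have "ys = ys'"
  proof (rule nth_equalityI)
    show "length ys = length ys'"
      using len by simp
  next
    fix i assume "i < length ys"
    then have i: "i < length gs" by (simp only: len)
    show "ys ! i = ys' ! i"
      by (rule conjunct2[OF ys, rule_format, OF i, THEN conjunct2, rule_format,
            OF conjunct2[OF ys', rule_format, OF i]])
  qed
  with f have "computes f ys z" by simp
  then show ?case by (rule Comp.IH(2))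
next
  case (PrimRec_0 f xs y g)
  from PrimRec_0.prems have "computes f xs z" by (cases rule: computes.cases) auto
  then show ?case by (rule PrimRec_0.IH)
next
  case (PrimRec_Suc f g n xs r y)
  from PrimRec_Suc.prems obtain r' where
    "computes (PrimRec f g) (n # xs) r'" and "computes g (n # r' # xs) z"
    by (cases rule: computes.cases) auto
  with PrimRec_Suc.IH show ?case by blast
next
  case (Minim f n xs)
  from Minim.prems have z: "computes f (z # xs) 0 \<and> (\<forall>m<z. \<exists>y. computes f (m # xs) (Suc y))"
    by (cases rule: computes.cases) auto
  show ?case
  proof (rule linorder_cases[of n z])
    assume "n < z"
    with z Minim.IH(1) show ?thesis by blast
  next
    assume "z < n"
    with z Minim.IH(2) show ?thesis by blast
  qed
qed


section \<open>Groups given by presentations\<close>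

text \<open>The letter \<open>(x, True)\<close> is the generator \<open>x\<close>, the letter \<open>(x, False)\<close> its formal inverse.\<close>

type_synonym 'x word = "('x \<times> bool) list"

definition words :: "'x set \<Rightarrow> 'x word set" where
  "words X = lists (X \<times> UNIV)"

text \<open>
  A relation is an equation between two words; a relator \<open>r\<close> is the relation \<open>(r, [])\<close>.
  \<open>pres_eq X R\<close> is equality in \<open>\<langle>X | R\<rangle>\<close>: the least congruence on the monoid of words
  that contains \<open>R\<close> and makes each letter and its formal inverse mutually inverse.
\<close>

inductive pres_eq :: "'x set \<Rightarrow> ('x word \<times> 'x word) set \<Rightarrow> 'x word \<Rightarrow> 'x word \<Rightarrow> bool"
  for X :: "'x set" and R :: "('x word \<times> 'x word) set" where
  refl: "u \<in> words X \<Longrightarrow> pres_eq X R u u"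
| sym: "pres_eq X R u v \<Longrightarrow> pres_eq X R v u"
| trans: "pres_eq X R u v \<Longrightarrow> pres_eq X R v w \<Longrightarrow> pres_eq X R u w"
| append: "pres_eq X R u u' \<Longrightarrow> pres_eq X R v v' \<Longrightarrow> pres_eq X R (u @ v) (u' @ v')"
| cancel: "x \<in> X \<Longrightarrow> pres_eq X R [(x, b), (x, \<not> b)] []"
| relation: "(u, v) \<in> R \<Longrightarrow> u \<in> words X \<Longrightarrow> v \<in> words X \<Longrightarrow> pres_eq X R u v"

definition word_class :: "'x set \<Rightarrow> ('x word \<times> 'x word) set \<Rightarrow> 'x word \<Rightarrow> 'x word set" where
  "word_class X R w = {v. pres_eq X R w v}"

definition presented_group ::
  "'x set \<Rightarrow> ('x word \<times> 'x word) set \<Rightarrow> 'x word set monoid" where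
  "presented_group X R =
    \<lparr>carrier = word_class X R ` words X,
     mult = (\<lambda>U V. \<Union>u\<in>U. \<Union>v\<in>V. word_class X R (u @ v)),
     one = word_class X R []\<rparr>"

lemma pres_eq_words: "pres_eq X R u v \<Longrightarrow> u \<in> words X \<and> v \<in> words X"
  by (induction rule: pres_eq.induct) (auto simp: words_def)

lemma word_class_eq_iff:
  assumes "u \<in> words X"
  shows "word_class X R u = word_class X R v \<longleftrightarrow> pres_eq X R u v"
proof
  assume eq: "word_class X R u = word_class X R v"
  have "u \<in> word_class X R u"
    using assms by (simp add: word_class_def pres_eq.refl)
  then have "pres_eq X R v u"
    unfolding eq by (simp add: word_class_def)
  then show "pres_eq X R u v" by (rule pres_eq.sym)
next
  assume uv: "pres_eq X R u v"
  show "word_class X R u = word_class X R v"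
    unfolding word_class_def
    using pres_eq.trans[OF uv] pres_eq.trans[OF pres_eq.sym[OF uv]] by blast
qed

lemma presented_group_mult:
  assumes "u \<in> words X" "v \<in> words X"
  shows "word_class X R u \<otimes>\<^bsub>presented_group X R\<^esub> word_class X R v = word_class X R (u @ v)"
proof -
  have "word_class X R (u' @ v') = word_class X R (u @ v)"
    if "u' \<in> word_class X R u" "v' \<in> word_class X R v" for u' v'
  proof -
    have "pres_eq X R (u' @ v') (u @ v)"
      using that unfolding word_class_def mem_Collect_eq
      by (intro pres_eq.append) (erule pres_eq.sym)+
    then show ?thesis
      using pres_eq_words word_class_eq_iff by blast
  qed
  moreover have "u \<in> word_class X R u" "v \<in> word_class X R v"
    using assms by (auto simp: word_class_def intro: pres_eq.refl)
  ultimately have "(\<Union>u'\<in>word_class X R u. \<Union>v'\<in>word_class X R v. word_class X R (u' @ v'))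
      = word_class X R (u @ v)"
    by blast
  then show ?thesis
    by (simp add: presented_group_def)
qed

lemma pres_eq_inverse:
  "w \<in> words X \<Longrightarrow> pres_eq X R (map (\<lambda>(x, b). (x, \<not> b)) (rev w) @ w) []"
proof (induction w)
  case Nil
  then show ?case by (auto simp: words_def intro: pres_eq.refl)
next
  case (Cons l w)
  obtain x b where l: "l = (x, b)" by (cases l)
  let ?i = "map (\<lambda>(x, b). (x, \<not> b)) (rev w)"
  have x: "x \<in> X" and w: "w \<in> words X" and i: "?i \<in> words X"
    using Cons.prems l by (auto simp: words_def)
  have "pres_eq X R ([(x, \<not> b), (x, b)] @ w) ([] @ w)"
    using pres_eq.cancel[OF x, of R "\<not> b"] pres_eq.refl[OF w] by (intro pres_eq.append) auto
  then have "pres_eq X R (?i @ [(x, \<not> b), (x, b)] @ w) (?i @ w)"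
    using pres_eq.append[OF pres_eq.refl[OF i]] by simp
  then show ?case
    using pres_eq.trans[OF _ Cons.IH[OF w]] l by simp
qed

lemma group_presented_group: "group (presented_group X R)"
proof (rule groupI)
  let ?G = "presented_group X R"
  have carrier: "carrier ?G = word_class X R ` words X"
    and one: "\<one>\<^bsub>?G\<^esub> = word_class X R []"
    by (simp_all add: presented_group_def)
  have nil: "[] \<in> words X" and app: "\<And>u v. u \<in> words X \<Longrightarrow> v \<in> words X \<Longrightarrow> u @ v \<in> words X"
    by (auto simp: words_def)
  note [simp] = carrier one nil app presented_group_mult
  show "\<one>\<^bsub>?G\<^esub> \<in> carrier ?G" by simp
  show "x \<otimes>\<^bsub>?G\<^esub> y \<in> carrier ?G" if "x \<in> carrier ?G" "y \<in> carrier ?G" for x y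
    using that by auto
  show "x \<otimes>\<^bsub>?G\<^esub> y \<otimes>\<^bsub>?G\<^esub> z = x \<otimes>\<^bsub>?G\<^esub> (y \<otimes>\<^bsub>?G\<^esub> z)"
    if "x \<in> carrier ?G" "y \<in> carrier ?G" "z \<in> carrier ?G" for x y z
    using that by auto
  show "\<one>\<^bsub>?G\<^esub> \<otimes>\<^bsub>?G\<^esub> x = x" if "x \<in> carrier ?G" for x
    using that by auto
  show "\<exists>y\<in>carrier ?G. y \<otimes>\<^bsub>?G\<^esub> x = \<one>\<^bsub>?G\<^esub>" if x: "x \<in> carrier ?G" for x
  proof -
    obtain w where w: "w \<in> words X" "x = word_class X R w" using x unfolding carrier by blast
    let ?i = "map (\<lambda>(x, b). (x, \<not> b)) (rev w)"
    have i: "?i \<in> words X" using w by (auto simp: words_def)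
    have "word_class X R ?i \<otimes>\<^bsub>?G\<^esub> x = \<one>\<^bsub>?G\<^esub>"
      unfolding w(2) presented_group_mult[OF i w(1)] one
      using word_class_eq_iff pres_eq_inverse[OF w(1)] pres_eq_words by blast
    moreover have "word_class X R ?i \<in> carrier ?G"
      unfolding carrier using i by (rule imageI)
    ultimately show ?thesis by blast
  qed
qed


section \<open>Amalgamated products and conjugacy of subgroups\<close>

text \<open>
  Elements of \<open>\<langle>X\<^sub>i | R\<^sub>i\<rangle>\<close> are sets of words, so the relation
  \<open>\<phi>\<^sub>1(a) = \<phi>\<^sub>2(a)\<close> is rendered by equating every word representing
  \<open>\<phi>\<^sub>1(a)\<close> with every word representing \<open>\<phi>\<^sub>2(a)\<close>. In the presence
  of \<open>R\<^sub>1\<close> and \<open>R\<^sub>2\<close> this gives the same group as choosing one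
  representative on each side.
\<close>

definition amalgam_relations ::
  "('x word \<times> 'x word) set \<Rightarrow> ('x word \<times> 'x word) set \<Rightarrow> 'a set \<Rightarrow>
   ('a \<Rightarrow> 'x word set) \<Rightarrow> ('a \<Rightarrow> 'x word set) \<Rightarrow> ('x word \<times> 'x word) set" where
  "amalgam_relations R1 R2 Y \<phi>1 \<phi>2 = R1 \<union> R2 \<union> (\<Union>a\<in>Y. \<phi>1 a \<times> \<phi>2 a)"

definition conjugate_subgroups :: "('g, 'm) monoid_scheme \<Rightarrow> 'g set \<Rightarrow> 'g set \<Rightarrow> bool" where
  "conjugate_subgroups G H K \<longleftrightarrow> (\<exists>g\<in>carrier G. K = g <#\<^bsub>G\<^esub> (H #>\<^bsub>G\<^esub> inv\<^bsub>G\<^esub> g))"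

definition subgroup_of_words ::
  "'x set \<Rightarrow> ('x word \<times> 'x word) set \<Rightarrow> 'x word list \<Rightarrow> 'x word set set" where
  "subgroup_of_words X R ws = generate (presented_group X R) (word_class X R ` set ws)"


section \<open>Coding of inputs\<close>

definition letter_code :: "('x \<Rightarrow> nat) \<Rightarrow> 'x \<times> bool \<Rightarrow> nat" where
  "letter_code c = (\<lambda>(x, b). prod_encode (c x, of_bool b))"

definition word_code :: "('x \<Rightarrow> nat) \<Rightarrow> 'x word \<Rightarrow> nat" where
  "word_code c w = list_encode (map (letter_code c) w)"

definition words_code :: "('x \<Rightarrow> nat) \<Rightarrow> 'x word list \<Rightarrow> nat" where
  "words_code c ws = list_encode (map (word_code c) ws)"

end

theory Submission
  imports Defs "HOL-Library.More_List"
begin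

text \<open>
  Let \<open>B1\<close> and \<open>B2\<close> be the images of the two factors in \<open>G\<close>, let \<open>A = B1 \<inter> B2\<close> and
  \<open>S = B1 \<union> B2\<close>. These are finite sets, and \<open>S\<close> generates \<open>G\<close>. Everything needed about
  the Bass-Serre tree of \<open>G\<close> is condensed into one function \<open>side\<close> from \<open>G\<close> to the truth
  values: it is constant on the cosets \<open>xB1\<close>, and along a step from \<open>x\<close> to \<open>xb\<close> with
  \<open>b \<in> B2\<close> it changes exactly if one of \<open>x\<close> and \<open>xb\<close> lies in \<open>A\<close> and the other does not.
  It says on which side of the edge \<open>A\<close> of the tree an element lies, so its existence means
  that every edge of the tree is a bridge. It is computed letter by letter along words, and it
  is invariant under the relations of \<open>G\<close> since each relation has each of its two sides
  written in the letters of a single factor (\<open>two_part_presentation.sided_group\<close>).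

  Three consequences carry the proof. The first is the normal form theorem
  \<open>alternating_list_prod\<close>: a nonempty product of elements of \<open>S - A\<close> taken alternately
  from the two factors does not lie in \<open>A\<close>.

  The second is that membership in \<open>K = \<langle>k\<^sub>1,\<dots>,k\<^sub>t\<rangle>\<close> is decidable. Draw the words
  \<open>k\<^sub>j\<close> as loops at a base point, and the word \<open>w\<close> to be tested as a path from it. Whenever two
  consecutive edges carry elements of the same factor, add the edge that carries their product.
  By the normal form theorem a walk with product \<open>1\<close> can be shortened in this way until it
  is a single edge (\<open>saturated_walk\<close>). Hence \<open>w \<in> K\<close> if and only if every set of edges that
  contains the drawing and is closed under this operation has an edge labelled \<open>1\<close> from the end
  of \<open>w\<close> to the base point (\<open>saturated_if_member\<close>, \<open>coset_triples\<close>). Only the finitely many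
  sets of edges between the points of the drawing matter.

  The third is a bound on conjugators (\<open>bounded_conjugators\<close>). Suppose that
  \<open>K = gHg\<inverse>\<close>. The sets \<open>Y = KP\<close> and \<open>Y' = gHQ\<close>, where \<open>P\<close> and \<open>Q\<close> consist of the
  values of the prefixes of the given generators of \<open>K\<close> and \<open>H\<close>, are \<open>K\<close>-invariant and
  connected. If they come close to each other, then \<open>ubv\<inverse>\<close> conjugates \<open>H\<close> to \<open>K\<close> for some
  \<open>u \<in> P\<close>, \<open>v \<in> Q\<close>, \<open>b \<in> S\<close>. If they do not, then a shortest path from \<open>Y\<close> to \<open>Y'\<close> begins by
  crossing an edge of the tree that separates \<open>Y\<close> from \<open>Y'\<close>, and \<open>K\<close> must fix this edge; so \<open>K\<close>
  is conjugate into the finite group \<open>A\<close> by some \<open>ub\<close>, and by symmetry \<open>H\<close> by some \<open>vb'\<close>. As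
  \<open>A\<close> has only finitely many subgroups, there is in all cases a conjugator \<open>udv\<inverse>\<close> with
  \<open>d\<close> in a finite set that depends on \<open>G\<close> alone.

  So \<open>H\<close> and \<open>K\<close> are conjugate if and only if one of finitely many explicit words \<open>g\<close> satisfies
  \<open>gh\<^sub>ig\<inverse> \<in> K\<close> and \<open>g\<inverse>k\<^sub>jg \<in> H\<close> for all \<open>i\<close> and \<open>j\<close>. Together with
  the membership test this is an arithmetical formula all of whose quantifiers are bounded, and
  such formulas are decided by recursive functions.
\<close>

section \<open>Recursive functions\<close>

text \<open>
  The arity is left open, and missing arguments read as \<open>0\<close> in \<open>arg\<close>. A function is then
  written with \<open>arg i v\<close> for its \<open>i\<close>-th variable, and a bound variable is added in front of \<open>v\<close>;
  the closure properties below can be applied to such terms by plain resolution.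
\<close>

definition recursive :: "(nat list \<Rightarrow> nat) \<Rightarrow> bool" where
  "recursive f \<longleftrightarrow> (\<forall>n. \<exists>p. \<forall>v. length v = n \<longrightarrow> computes p v (f v))"

definition arg :: "nat \<Rightarrow> nat list \<Rightarrow> nat" where
  "arg i v = nth_default 0 v i"

lemma arg_Cons [simp]: "arg 0 (x # v) = x" "arg (Suc i) (x # v) = arg i v"
  by (simp_all add: arg_def)

lemma arg_tl: "arg i (tl v) = arg (Suc i) v"
  by (cases v) (simp_all add: arg_def nth_default_def)

named_theorems recursive_intros

lemma recursiveD:
  "recursive f \<Longrightarrow> \<exists>p. \<forall>v. length v = n \<longrightarrow> computes p v (f v)"
  unfolding recursive_def by blast

lemma recursive_const [recursive_intros]: "recursive (\<lambda>v. k)"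
proof -
  have "\<exists>p. \<forall>v. computes p v k" for k
  proof (induction k)
    case 0
    show ?case using computes.Zero by blast
  next
    case (Suc k)
    then obtain p where p: "\<And>v. computes p v k" by blast
    have "computes (Comp recf.Succ [p]) v (Suc k)" for v
      by (rule computes.Comp[where ys = "[k]"]) (simp_all add: p computes.Succ)
    then show ?case by blast
  qed
  then show ?thesis unfolding recursive_def by blast
qed

lemma recursive_arg [recursive_intros]: "recursive (arg i)"
proof (unfold recursive_def, intro allI)
  fix n
  show "\<exists>p. \<forall>v. length v = n \<longrightarrow> computes p v (arg i v)"
  proof (cases "i < n")
    case True
    then show ?thesis
      by (intro exI[of _ "Proj i"]) (auto simp: arg_def nth_default_def intro: computes.Proj)
  next
    case False
    then show ?thesis
      by (intro exI[of _ Zero]) (auto simp: arg_def nth_default_def intro: computes.Zero)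
  qed
qed

lemma computes_projections:
  "list_all2 (\<lambda>g y. computes g v y) (map Proj [k..<length v]) (drop k v)"
  by (auto simp: list_all2_conv_all_nth intro!: computes.Proj)

text \<open>
  Composition in the form needed for bound variables: the values of \<open>gs\<close> become new leading
  arguments, and the first \<open>k\<close> old arguments are dropped.
\<close>

lemma recursive_comp:
  assumes F: "recursive F" and gs: "\<And>g. g \<in> set gs \<Longrightarrow> recursive g"
  shows "recursive (\<lambda>v. F (map (\<lambda>g. g v) gs @ drop k v))"
proof (unfold recursive_def, intro allI)
  fix n
  obtain p where p: "\<And>v. length v = length gs + (n - k) \<Longrightarrow> computes p v (F v)"
    using recursiveD[OF F] by blast
  have "\<exists>ps. \<forall>v. length v = n \<longrightarrow>
      list_all2 (\<lambda>q y. computes q v y) ps (map (\<lambda>g. g v) gs)"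
    using gs
  proof (induction gs)
    case Nil
    show ?case by (rule exI[of _ "[]"]) simp
  next
    case (Cons g gs)
    then obtain ps where "\<forall>v. length v = n \<longrightarrow>
        list_all2 (\<lambda>q y. computes q v y) ps (map (\<lambda>g. g v) gs)" by auto
    moreover obtain q where "\<And>v. length v = n \<Longrightarrow> computes q v (g v)"
      using recursiveD[OF Cons.prems[of g], of n] by auto
    ultimately show ?case by (intro exI[of _ "q # ps"]) simp
  qed
  then obtain ps where ps: "\<And>v. length v = n \<Longrightarrow>
      list_all2 (\<lambda>q y. computes q v y) ps (map (\<lambda>g. g v) gs)" by blast
  have "computes (Comp p (ps @ map Proj [k..<n])) v (F (map (\<lambda>g. g v) gs @ drop k v))"
    if v: "length v = n" for v
    by (rule computes.Comp[OF list_all2_appendI[OF ps[OF v]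
            computes_projections[of v k, unfolded v]]]) (rule p, simp add: v)
  then show "\<exists>p. \<forall>v. length v = n \<longrightarrow> computes p v (F (map (\<lambda>g. g v) gs @ drop k v))"
    by blast
qed

lemma recursive_tl: "recursive f \<Longrightarrow> recursive (\<lambda>v. f (tl v))"
  using recursive_comp[of f "[]" 1] by (simp add: drop_Suc)

lemma recursive_compose1:
  assumes "recursive (\<lambda>v. F (arg 0 v))" "recursive f"
  shows "recursive (\<lambda>v. F (f v))"
  using recursive_comp[OF assms(1), of "[f]" 0] assms(2) by simp

lemma recursive_compose2:
  assumes "recursive (\<lambda>v. F (arg 0 v) (arg 1 v))" "recursive f" "recursive g"
  shows "recursive (\<lambda>v. F (f v) (g v))"
  using recursive_comp[OF assms(1), of "[f, g]" 0] assms(2-) by auto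

lemma recursive_compose3:
  assumes "recursive (\<lambda>v. F (arg 0 v) (arg 1 v) (arg 2 v))" "recursive f" "recursive g" "recursive h"
  shows "recursive (\<lambda>v. F (f v) (g v) (h v))"
  using recursive_comp[OF assms(1), of "[f, g, h]" 0] assms(2-) by (auto simp: numeral_2_eq_2)

lemma recursive_rec_nat:
  assumes a: "recursive a" and g: "recursive (\<lambda>v. g (arg 0 v) (arg 1 v) (tl (tl v)))"
    and b: "recursive b"
  shows "recursive (\<lambda>v. rec_nat (a v) (\<lambda>m r. g m r v) (b v))"
proof (unfold recursive_def, intro allI)
  fix n
  obtain p where p: "\<And>v. length v = n \<Longrightarrow> computes p v (a v)"
    using recursiveD[OF a] by blast
  obtain q where q: "\<And>v. length v = Suc (Suc n) \<Longrightarrow>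
      computes q v (g (arg 0 v) (arg 1 v) (tl (tl v)))"
    using recursiveD[OF g] by blast
  obtain r where r: "\<And>v. length v = n \<Longrightarrow> computes r v (b v)"
    using recursiveD[OF b] by blast
  have loop: "computes (PrimRec p q) (m # v) (rec_nat (a v) (\<lambda>m r. g m r v) m)"
    if v: "length v = n" for m v
  proof (induction m)
    case 0
    show ?case using p[OF v] by (simp add: computes.PrimRec_0)
  next
    case (Suc m)
    let ?r = "rec_nat (a v) (\<lambda>m r. g m r v) m"
    have "computes q (m # ?r # v) (g m ?r v)"
      using q[of "m # ?r # v"] v by simp
    with Suc show ?case by (simp add: computes.PrimRec_Suc)
  qed
  have "computes (Comp (PrimRec p q) (r # map Proj [0..<n])) v
      (rec_nat (a v) (\<lambda>m r. g m r v) (b v))" if v: "length v = n" for v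
    by (rule computes.Comp[OF _ loop[OF v]])
      (use r[OF v] computes_projections[of v 0] v in simp)
  then show "\<exists>p. \<forall>v. length v = n \<longrightarrow> computes p v (rec_nat (a v) (\<lambda>m r. g m r v) (b v))"
    by blast
qed

section \<open>Arithmetic, bounded quantifiers and coded lists\<close>

lemma recursive_Suc [recursive_intros]:
  assumes "recursive f"
  shows "recursive (\<lambda>v. Suc (f v))"
proof (rule recursive_compose1[OF _ assms])
  show "recursive (\<lambda>v. Suc (arg 0 v))"
  proof (unfold recursive_def, intro allI)
    fix n
    show "\<exists>p. \<forall>v. length v = n \<longrightarrow> computes p v (Suc (arg 0 v))"
    proof -
      obtain q where q: "\<And>v. length v = n \<Longrightarrow> computes q v (arg 0 v)"
        using recursiveD[OF recursive_arg] by blast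
      have "computes (Comp recf.Succ [q]) v (Suc (arg 0 v))" if "length v = n" for v
        by (rule computes.Comp[where ys = "[arg 0 v]"]) (simp_all add: q that computes.Succ)
      then show ?thesis by blast
    qed
  qed
qed

lemma recursive_add [recursive_intros]:
  assumes "recursive f" "recursive g"
  shows "recursive (\<lambda>v. f v + g v)"
proof -
  have "rec_nat a (\<lambda>_. Suc) b = a + b" for a b by (induction b) simp_all
  moreover have "recursive (\<lambda>v. rec_nat (f v) (\<lambda>_ r. Suc r) (g v))"
    by (intro recursive_intros recursive_rec_nat assms)
  ultimately show ?thesis by simp
qed

lemma recursive_diff [recursive_intros]:
  assumes "recursive f" "recursive g"
  shows "recursive (\<lambda>v. f v - g v)"
proof -
  have pred: "recursive (\<lambda>v. rec_nat 0 (\<lambda>m _. m) (f v))" if "recursive f" for f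
    by (intro recursive_intros recursive_rec_nat that)
  have "rec_nat a (\<lambda>_ r. rec_nat 0 (\<lambda>m _. m) r) b = a - b" for a b :: nat
  proof (induction b)
    case (Suc b)
    then show ?case by (cases "a - b") auto
  qed simp
  moreover have "recursive (\<lambda>v. rec_nat (f v) (\<lambda>_ r. rec_nat 0 (\<lambda>m _. m) r) (g v))"
    by (intro recursive_intros recursive_rec_nat[where g = "\<lambda>m r v. rec_nat 0 (\<lambda>m _. m) r"]
        pred assms)
  ultimately show ?thesis by simp
qed

lemma recursive_mult [recursive_intros]:
  assumes "recursive f" "recursive g"
  shows "recursive (\<lambda>v. f v * g v)"
proof -
  have "rec_nat 0 (\<lambda>_ r. r + a) b = a * b" for a b :: nat by (induction b) simp_all
  moreover have "recursive (\<lambda>v. rec_nat 0 (\<lambda>_ r. r + f v) (g v))"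
    by (intro recursive_intros recursive_rec_nat recursive_tl assms)
  ultimately show ?thesis by simp
qed

lemma recursive_power2 [recursive_intros]:
  assumes "recursive f"
  shows "recursive (\<lambda>v. 2 ^ f v)"
proof -
  have "rec_nat 1 (\<lambda>_ r. r + r) b = (2::nat) ^ b" for b :: nat by (induction b) simp_all
  moreover have "recursive (\<lambda>v. rec_nat 1 (\<lambda>_ r. r + r) (f v))"
    by (intro recursive_intros recursive_rec_nat assms)
  ultimately show ?thesis by simp
qed

lemma recursive_sum [recursive_intros]:
  assumes f: "recursive (\<lambda>v. f (arg 0 v) (tl v))" and b: "recursive b"
  shows "recursive (\<lambda>v. \<Sum>m<b v. f m v)"
proof -
  have "recursive (\<lambda>v. f (arg 0 v) (tl (tl v)))"
    using recursive_comp[OF f, of "[arg 0]" 2] recursive_arg by (simp add: numeral_2_eq_2 drop_Suc)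
  then have "recursive (\<lambda>v. rec_nat 0 (\<lambda>m r. r + f m v) (b v))"
    by (intro recursive_intros recursive_rec_nat b)
  moreover have "rec_nat 0 (\<lambda>m r. r + f m v) k = (\<Sum>m<k. f m v)" for k v
    by (induction k) simp_all
  ultimately show ?thesis by simp
qed

lemma recursive_not [recursive_intros]:
  assumes "recursive (\<lambda>v. of_bool (P v))"
  shows "recursive (\<lambda>v. of_bool (\<not> P v))"
proof -
  have "recursive (\<lambda>v. 1 - of_bool (P v))"
    by (intro recursive_intros assms)
  moreover have "1 - of_bool (P v) = (of_bool (\<not> P v) :: nat)" for v by simp
  ultimately show ?thesis by (simp only:)
qed

lemma recursive_conj [recursive_intros]:
  assumes "recursive (\<lambda>v. of_bool (P v))" "recursive (\<lambda>v. of_bool (Q v))"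
  shows "recursive (\<lambda>v. of_bool (P v \<and> Q v))"
  unfolding of_bool_conj by (intro recursive_intros assms)

lemma recursive_disj [recursive_intros]:
  assumes "recursive (\<lambda>v. of_bool (P v))" "recursive (\<lambda>v. of_bool (Q v))"
  shows "recursive (\<lambda>v. of_bool (P v \<or> Q v))"
proof -
  have "recursive (\<lambda>v. of_bool (\<not> (\<not> P v \<and> \<not> Q v)))"
    by (intro recursive_intros assms)
  then show ?thesis by simp
qed

lemma recursive_imp [recursive_intros]:
  assumes "recursive (\<lambda>v. of_bool (P v))" "recursive (\<lambda>v. of_bool (Q v))"
  shows "recursive (\<lambda>v. of_bool (P v \<longrightarrow> Q v))"
  unfolding imp_conv_disj by (intro recursive_intros assms)

lemma recursive_le [recursive_intros]:
  assumes "recursive f" "recursive g"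
  shows "recursive (\<lambda>v. of_bool (f v \<le> g v))"
proof -
  have "of_bool (a \<le> b) = 1 - (a - b)" for a b :: nat by auto
  moreover have "recursive (\<lambda>v. 1 - (f v - g v))"
    by (intro recursive_intros assms)
  ultimately show ?thesis by (simp only:)
qed

lemma recursive_less [recursive_intros]:
  assumes "recursive f" "recursive g"
  shows "recursive (\<lambda>v. of_bool (f v < g v))"
  unfolding less_eq_Suc_le by (intro recursive_intros assms)

lemma recursive_eq [recursive_intros]:
  assumes "recursive f" "recursive g"
  shows "recursive (\<lambda>v. of_bool (f v = g v))"
  unfolding order_eq_iff by (intro recursive_intros assms)

lemma recursive_if [recursive_intros]:
  assumes "recursive (\<lambda>v. of_bool (P v))" "recursive f" "recursive g"
  shows "recursive (\<lambda>v. if P v then f v else g v)"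
proof -
  have "(if P v then f v else g v) = of_bool (P v) * f v + of_bool (\<not> P v) * g v" for v
    by simp
  moreover have "recursive (\<lambda>v. of_bool (P v) * f v + of_bool (\<not> P v) * g v)"
    by (intro recursive_intros assms)
  ultimately show ?thesis by (simp only:)
qed

lemma recursive_bex [recursive_intros]:
  assumes "recursive (\<lambda>v. of_bool (P (arg 0 v) (tl v)))" "recursive b"
  shows "recursive (\<lambda>v. of_bool (\<exists>m<b v. P m v))"
proof -
  have "(\<exists>m<k. P m v) \<longleftrightarrow> 0 < (\<Sum>m<k. of_bool (P m v) :: nat)" for k v
    by (induction k) (auto simp: less_Suc_eq)
  moreover have "recursive (\<lambda>v. of_bool (0 < (\<Sum>m<b v. of_bool (P m v) :: nat)))"
    by (intro recursive_intros assms)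
  ultimately show ?thesis by (simp only:)
qed

lemma recursive_ball [recursive_intros]:
  assumes "recursive (\<lambda>v. of_bool (P (arg 0 v) (tl v)))" "recursive b"
  shows "recursive (\<lambda>v. of_bool (\<forall>m<b v. P m v))"
proof -
  have "recursive (\<lambda>v. of_bool (\<not> (\<exists>m<b v. \<not> P m v)))"
    by (intro recursive_intros assms)
  then show ?thesis by simp
qed

text \<open>
  A function with a decidable graph and a recursive bound is recursive: it is the sum of all
  \<open>m\<close> up to the bound for which \<open>(v, m)\<close> is on the graph. No unbounded search is needed.
\<close>

lemma recursive_witness:
  assumes "recursive (\<lambda>v. of_bool (P (arg 0 v) (tl v)))" "recursive b"
    and "\<And>v m. P m v \<longleftrightarrow> m = f v" "\<And>v. f v \<le> b v"
  shows "recursive f"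
proof -
  have "recursive (\<lambda>v. \<Sum>m<Suc (b v). m * of_bool (P m v))"
    by (intro recursive_intros assms)
  moreover have "(\<Sum>m<Suc (b v). m * of_bool (P m v)) = f v" for v
  proof -
    have "(\<Sum>m<Suc (b v). m * of_bool (P m v)) = (\<Sum>m<Suc (b v). if m = f v then f v else 0)"
      by (intro sum.cong) (auto simp: assms(3))
    then show ?thesis using assms(4)[of v] by (simp add: sum.delta del: sum.lessThan_Suc)
  qed
  ultimately show ?thesis by (simp only:)
qed

text \<open>
  Finite sets of numbers are coded by the binary digits of a number, so that a quantifier over
  the subsets of \<open>{..<b}\<close> becomes a quantifier bounded by \<open>2 ^ b\<close>.
\<close>

lemma recursive_bit [recursive_intros]:
  assumes "recursive f" "recursive g"
  shows "recursive (\<lambda>v. of_bool (f v \<in> set_decode (g v)))"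
proof -
  have half: "recursive (\<lambda>v. f v div 2)" if "recursive f" for f
  proof -
    have "rec_nat 0 (\<lambda>m r. m - r) k = k div 2" for k :: nat
      by (induction k) auto
    moreover have "recursive (\<lambda>v. rec_nat 0 (\<lambda>m r. m - r) (f v))"
      by (intro recursive_intros recursive_rec_nat that)
    ultimately show ?thesis by simp
  qed
  have "rec_nat t (\<lambda>_ r. r div 2) k = t div 2 ^ k" for t k :: nat
    by (induction k) (simp_all add: power_Suc2 div_mult2_eq del: power_Suc)
  moreover have "recursive (\<lambda>v. rec_nat (g v) (\<lambda>_ r. r div 2) (f v))"
    by (intro half recursive_intros recursive_rec_nat assms)
  ultimately have shift: "recursive (\<lambda>v. g v div 2 ^ f v)" by presburger
  have "odd n \<longleftrightarrow> \<not> n \<le> 2 * (n div 2)" for n :: nat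
    by presburger
  then have "f v \<in> set_decode (g v) \<longleftrightarrow>
      \<not> g v div 2 ^ f v \<le> 2 * (g v div 2 ^ f v div 2)" for v
    unfolding set_decode_def by blast
  moreover have "recursive (\<lambda>v. of_bool (\<not> g v div 2 ^ f v \<le> 2 * (g v div 2 ^ f v div 2)))"
    by (intro half[of "\<lambda>v. g v div 2 ^ f v"] recursive_not recursive_le recursive_mult
        recursive_const shift)
  ultimately show ?thesis by (simp only:)
qed

lemma recursive_prod_encode [recursive_intros]:
  assumes "recursive f" "recursive g"
  shows "recursive (\<lambda>v. prod_encode (f v, g v))"
proof -
  have "triangle k = (\<Sum>m<Suc k. m)" for k
    by (induction k) simp_all
  moreover have "recursive (\<lambda>v. (\<Sum>m<Suc (f v + g v). m) + f v)"
    by (intro recursive_intros assms)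
  ultimately show ?thesis by (simp add: prod_encode_def)
qed

lemma recursive_fst_decode [recursive_intros]:
  assumes "recursive f"
  shows "recursive (\<lambda>v. fst (prod_decode (f v)))"
proof (rule recursive_witness)
  show "recursive (\<lambda>v. of_bool (\<exists>n<Suc (f (tl v)). prod_encode (arg 0 v, n) = f (tl v)))"
    by (intro recursive_intros recursive_tl assms | simp only: arg_tl)+
  show "recursive f" by fact
  show "fst (prod_decode (f v)) \<le> f v" for v
    by (metis le_prod_encode_1 prod.collapse prod_decode_inverse)
  show "(\<exists>n<Suc (f v). prod_encode (m, n) = f v) \<longleftrightarrow> m = fst (prod_decode (f v))" for m v
    by (metis fst_conv le_imp_less_Suc le_prod_encode_2 prod.collapse prod_decode_inverse
        prod_encode_inverse)
qed

lemma recursive_snd_decode [recursive_intros]: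
  assumes "recursive f"
  shows "recursive (\<lambda>v. snd (prod_decode (f v)))"
proof (rule recursive_witness)
  show "recursive (\<lambda>v. of_bool (prod_encode (fst (prod_decode (f (tl v))), arg 0 v) = f (tl v)))"
    by (intro recursive_intros recursive_tl assms | simp only: arg_tl)+
  show "recursive f" by fact
  show "snd (prod_decode (f v)) \<le> f v" for v
    by (metis le_prod_encode_2 prod.collapse prod_decode_inverse)
  show "prod_encode (fst (prod_decode (f v)), m) = f v \<longleftrightarrow> m = snd (prod_decode (f v))" for m v
    by (metis prod.collapse prod_decode_inverse prod_encode_inverse snd_conv)
qed

text \<open>
  All data of a fixed finite group enter the algorithm through this lemma: a program may
  contain any finite table.
\<close>

lemma recursive_finite_table:
  assumes "finite {n. t n \<noteq> (0 :: nat)}" and "recursive f"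
  shows "recursive (\<lambda>v. t (f v))"
proof (rule recursive_compose1[OF _ assms(2)])
  have "recursive (\<lambda>v. \<Sum>a\<in>F. of_bool (arg 0 v = a) * t a)" if "finite F" for F
    using that
  proof induction
    case empty
    show ?case by (simp add: recursive_const)
  next
    case (insert x F)
    then have "recursive (\<lambda>v. of_bool (arg 0 v = x) * t x + (\<Sum>a\<in>F. of_bool (arg 0 v = a) * t a))"
      by (intro recursive_intros)
    with insert.hyps show ?case by (simp del: sum_of_bool_mult_eq)
  qed
  moreover have table: "t n = (\<Sum>a\<in>{n. t n \<noteq> 0}. of_bool (n = a) * t a)" for n
  proof -
    have "(\<Sum>a\<in>{n. t n \<noteq> 0}. of_bool (n = a) * t a) = (\<Sum>a\<in>{n. t n \<noteq> 0}. if n = a then t n else 0)"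
      by (intro sum.cong) auto
    then show ?thesis using assms(1) by simp
  qed
  ultimately show "recursive (\<lambda>v. t (arg 0 v))"
    by (subst table) (use assms(1) in blast)
qed

lemma list_code_split:
  "list_decode z = (if z = 0 then [] else
     fst (prod_decode (z - 1)) # list_decode (snd (prod_decode (z - 1))))"
  by (cases z) (simp_all add: case_prod_beta)

lemma recursive_drop [recursive_intros]:
  assumes "recursive f" "recursive g"
  shows "recursive (\<lambda>v. list_encode (drop (f v) (list_decode (g v))))"
proof -
  have tl_code: "list_encode (tl (list_decode z)) =
      (if z = 0 then 0 else snd (prod_decode (z - 1)))" for z
    by (subst list_code_split) simp
  have tl: "recursive (\<lambda>v. list_encode (tl (list_decode (f v))))" if "recursive f" for f
    unfolding tl_code by (intro recursive_intros that)
  have "rec_nat z (\<lambda>_ r. list_encode (tl (list_decode r))) k =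
      list_encode (drop k (list_decode z))" for z k
    by (induction k) (auto simp: drop_Suc tl_drop)
  moreover have "recursive (\<lambda>v. rec_nat (g v) (\<lambda>_ r. list_encode (tl (list_decode r))) (f v))"
    by (intro tl recursive_intros recursive_rec_nat assms)
  ultimately show ?thesis by (simp only:)
qed

lemma length_list_decode_le: "length (list_decode z) \<le> z"
proof -
  have "length xs \<le> list_encode xs" for xs
    by (induction xs) (auto intro: le_trans[OF _ le_prod_encode_2])
  from this[of "list_decode z"] show ?thesis by simp
qed

lemma recursive_length [recursive_intros]:
  assumes "recursive f"
  shows "recursive (\<lambda>v. length (list_decode (f v)))"
proof -
  have zero: "list_encode xs = 0 \<longleftrightarrow> xs = []" for xs by (cases xs) simp_all
  have "(\<Sum>i<k. of_bool (list_encode (drop i xs) \<noteq> 0)) = min k (length xs)" for k xs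
    by (induction k) (auto simp: zero)
  then have "(\<Sum>i<z. of_bool (list_encode (drop i (list_decode z)) \<noteq> 0)) = length (list_decode z)"
    for z using length_list_decode_le[of z] by (simp add: min_def)
  moreover have "recursive (\<lambda>v. \<Sum>i<f v. of_bool (list_encode (drop i (list_decode (f v))) \<noteq> 0))"
    by (intro recursive_intros recursive_tl assms)
  ultimately show ?thesis by (simp only:)
qed

lemma recursive_nth [recursive_intros]:
  assumes "recursive f" "recursive g"
  shows "recursive (\<lambda>v. nth_default 0 (list_decode (f v)) (g v))"
proof -
  let ?d = "\<lambda>v. list_encode (drop (g v) (list_decode (f v)))"
  have "nth_default 0 xs i =
      (if i < length xs then fst (prod_decode (list_encode (drop i xs) - 1)) else 0)" for xs i
    by (auto simp: nth_default_def Cons_nth_drop_Suc[symmetric])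
  moreover have "recursive (\<lambda>v. if g v < length (list_decode (f v))
      then fst (prod_decode (?d v - 1)) else 0)"
    by (intro recursive_intros assms)
  ultimately show ?thesis by (simp only:)
qed

text \<open>
  The source of the list-valued operations on words: a list with recursive length and recursive
  entries. The code of a list is built from its last entry on, hence the index
  \<open>n - Suc m\<close> in the recursion.
\<close>

lemma recursive_tabulate [recursive_intros]:
  assumes f: "recursive (\<lambda>v. f (arg 0 v) (tl v))" and b: "recursive b"
  shows "recursive (\<lambda>v. list_encode (map (\<lambda>i. f i v) [0..<b v]))"
proof -
  have "rec_nat 0 (\<lambda>m r. Suc (prod_encode (f (n - Suc m) v, r))) k =
      list_encode (map (\<lambda>i. f i v) [n - k..<n])" if "k \<le> n" for n k v
    using that
  proof (induction k)
    case (Suc k)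
    then have "[n - Suc k..<n] = (n - Suc k) # [n - k..<n]"
      by (metis Suc_diff_Suc Suc_le_lessD diff_Suc_less less_le_trans upt_conv_Cons zero_less_Suc)
    with Suc show ?case by simp
  qed simp
  from this[of n n for n] have "rec_nat 0 (\<lambda>m r. Suc (prod_encode (f (n - Suc m) v, r))) n =
      list_encode (map (\<lambda>i. f i v) [0..<n])" for n v by simp
  moreover have "recursive (\<lambda>v. rec_nat 0 (\<lambda>m r. Suc (prod_encode (f (b v - Suc m) v, r))) (b v))"
  proof (intro recursive_intros recursive_rec_nat b)
    have "recursive (\<lambda>v. b (tl (tl v)) - Suc (arg 0 v))"
      by (intro recursive_intros recursive_tl[of "\<lambda>v. b (tl v)"] recursive_tl b)
    then show "recursive (\<lambda>v. f (b (tl (tl v)) - Suc (arg 0 v)) (tl (tl v)))"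
      using recursive_comp[OF f, of "[\<lambda>v. b (tl (tl v)) - Suc (arg 0 v)]" 2]
      by (simp add: numeral_2_eq_2 drop_Suc)
  qed
  ultimately show ?thesis by (simp only:)
qed

section \<open>Normal forms from a side function\<close>

context group
begin

definition list_prod :: "'a list \<Rightarrow> 'a" where
  "list_prod xs = foldr (\<otimes>) xs \<one>"

lemma list_prod_Nil [simp]: "list_prod [] = \<one>"
  and list_prod_Cons [simp]: "list_prod (x # xs) = x \<otimes> list_prod xs"
  by (simp_all add: list_prod_def)

lemma list_prod_closed [simp, intro]: "set xs \<subseteq> carrier G \<Longrightarrow> list_prod xs \<in> carrier G"
  by (induction xs) auto

lemma list_prod_append [simp]:
  "set xs \<subseteq> carrier G \<Longrightarrow> set ys \<subseteq> carrier G \<Longrightarrow> list_prod (xs @ ys) = list_prod xs \<otimes> list_prod ys"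
  by (induction xs) (auto simp: m_assoc)

lemma inv_mult_cancel:
  "x \<in> carrier G \<Longrightarrow> y \<in> carrier G \<Longrightarrow> inv x \<otimes> (x \<otimes> y) = y"
  "x \<in> carrier G \<Longrightarrow> y \<in> carrier G \<Longrightarrow> x \<otimes> (inv x \<otimes> y) = y"
  by (simp_all add: m_assoc[symmetric])

lemma subgroup_mult_right_iff:
  assumes "subgroup H G" "x \<in> carrier G" "a \<in> H"
  shows "x \<otimes> a \<in> H \<longleftrightarrow> x \<in> H"
proof
  interpret H: subgroup H G by fact
  assume "x \<otimes> a \<in> H"
  then have "x \<otimes> a \<otimes> inv a \<in> H" using assms(3) by blast
  then show "x \<in> H" using assms(2,3) by (simp add: m_assoc)
next
  assume "x \<in> H"
  then show "x \<otimes> a \<in> H" using assms(1,3) by (simp add: subgroup.m_closed)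
qed

end

text \<open>
  The vertices of the tree are the cosets of \<open>B1\<close> and \<open>B2\<close>, its edges the cosets of
  \<open>B1 \<inter> B2\<close>. Removing the edge \<open>B1 \<inter> B2\<close> leaves two halves; \<open>side x\<close> names the half with
  the vertex \<open>xB1\<close>. The halves for an arbitrary edge \<open>z(B1 \<inter> B2)\<close> are given by
  \<open>side (inv z \<otimes> x)\<close>.
\<close>

locale sided_group = group G for G (structure) +
  fixes B1 B2 :: "'a set" and side :: "'a \<Rightarrow> bool"
  assumes subgroups: "subgroup B1 G" "subgroup B2 G"
    and side_B1: "x \<in> carrier G \<Longrightarrow> b \<in> B1 \<Longrightarrow> side (x \<otimes> b) = side x"
    and side_B2: "x \<in> carrier G \<Longrightarrow> b \<in> B2 \<Longrightarrow>
      side (x \<otimes> b) = (side x \<noteq> ((x \<in> B1 \<inter> B2) \<noteq> (x \<otimes> b \<in> B1 \<inter> B2)))"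
begin

abbreviation "A \<equiv> B1 \<inter> B2"
abbreviation "S \<equiv> B1 \<union> B2"

definition common :: "'a \<Rightarrow> 'a \<Rightarrow> bool" where
  "common a b \<longleftrightarrow> a \<in> B1 \<and> b \<in> B1 \<or> a \<in> B2 \<and> b \<in> B2"

lemma S_carrier: "S \<subseteq> carrier G"
  using subgroups by (auto dest: subgroup.subset)

lemma inv_S: "b \<in> S \<Longrightarrow> inv b \<in> S"
  using subgroups by (auto dest: subgroup.m_inv_closed)

lemma one_A: "\<one> \<in> A"
  using subgroups by (auto dest: subgroup.one_closed)

lemma subgroup_A: "subgroup A G"
  using subgroups by (rule subgroups_Inter_pair)

lemma common_mult: "common a b \<Longrightarrow> a \<otimes> b \<in> S"
  using subgroups unfolding common_def by (auto intro: subgroup.m_closed)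

lemma common_A: "a \<in> A \<Longrightarrow> b \<in> S \<Longrightarrow> common a b \<and> common b a"
  unfolding common_def by auto

lemma A_mult_S: "a \<in> A \<Longrightarrow> b \<in> S \<Longrightarrow> a \<otimes> b \<in> S" "a \<in> A \<Longrightarrow> b \<in> S \<Longrightarrow> b \<otimes> a \<in> S"
  using common_A common_mult by blast+

lemma side_step:
  "x \<in> carrier G \<Longrightarrow> b \<in> S \<Longrightarrow> x \<notin> A \<Longrightarrow> x \<otimes> b \<notin> A \<Longrightarrow> side (x \<otimes> b) = side x"
  using side_B1 side_B2 by blast

lemma side_path:
  assumes "x \<in> carrier G" "set bs \<subseteq> S"
    and "\<And>i. i \<le> length bs \<Longrightarrow> x \<otimes> list_prod (take i bs) \<notin> A"
  shows "side (x \<otimes> list_prod bs) = side x"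
  using assms
proof (induction bs arbitrary: x)
  case (Cons b bs)
  have b: "b \<in> S" "b \<in> carrier G" and bs: "set bs \<subseteq> carrier G"
    using Cons.prems(2) S_carrier by auto
  have assoc: "x \<otimes> (b \<otimes> y) = x \<otimes> b \<otimes> y" if "y \<in> carrier G" for y
    using Cons.prems(1) b that by (simp add: m_assoc)
  have "side (x \<otimes> b \<otimes> list_prod bs) = side (x \<otimes> b)"
  proof (rule Cons.IH)
    show "x \<otimes> b \<otimes> list_prod (take i bs) \<notin> A" if "i \<le> length bs" for i
    proof -
      have "list_prod (take i bs) \<in> carrier G"
        using bs by (meson order_trans list_prod_closed set_take_subset)
      then show ?thesis
        using Cons.prems(3)[of "Suc i"] that by (simp add: assoc)
    qed
  qed (use Cons.prems b in auto)
  also have "side (x \<otimes> b) = side x"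
    using side_step[of x b] Cons.prems(3)[of 0] Cons.prems(3)[of 1] Cons.prems(1) b by simp
  finally show ?case using bs by (simp add: assoc)
qed simp

definition alternating :: "'a list \<Rightarrow> bool" where
  "alternating bs \<longleftrightarrow> set bs \<subseteq> S - A \<and> successively (\<lambda>a b. \<not> common a b) bs"

text \<open>
  Suppose that the product of a shortest counterexample lies in \<open>A\<close>. The proper prefixes lie
  outside \<open>A\<close>, so \<open>side\<close> can change only in the first and in the last step, and it does so
  exactly for those of the two steps that are made in \<open>B2\<close>. As \<open>side\<close> agrees at both ends, the
  first and the last element belong to the same factor. Conjugating cyclically by the last
  element merges the two; they are dropped if the result lies in \<open>A\<close>. In both cases this gives
  a shorter counterexample.
\<close>

lemma alternating_list_prod:
  assumes "alternating bs" "bs \<noteq> []"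
  shows "list_prod bs \<notin> A"
  using assms
proof (induction "length bs" arbitrary: bs rule: less_induct)
  case less
  note alt = less.prems(1)[unfolded alternating_def]
  have bsS: "set bs \<subseteq> S" and bsG: "set bs \<subseteq> carrier G" using alt S_carrier by auto
  consider b where "bs = [b]" | b mid c where "bs = b # mid @ [c]"
    using less.prems(2) by (metis append_butlast_last_id neq_Nil_conv)
  then show ?case
  proof cases
    case 1
    then show ?thesis using alt bsG by auto
  next
    case (2 b mid c)
    have mem: "b \<in> S - A" "c \<in> S - A" "b \<in> carrier G" "c \<in> carrier G" "set mid \<subseteq> S"
      "set mid \<subseteq> carrier G"
      using alt bsG 2 by auto
    have pref: "list_prod (take i bs) \<notin> A" if "0 < i" "i < length bs" for i
    proof (rule less.hyps)
      show "alternating (take i bs)"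
        using less.prems(1) unfolding alternating_def
        by (metis append_take_drop_id order_trans set_take_subset successively_append_iff)
    qed (use that in auto)
    show ?thesis
    proof
      assume prod: "list_prod bs \<in> A"
      have prefix_mid: "b \<otimes> list_prod (take i mid) \<notin> A" if "i \<le> length mid" for i
        using pref[of "Suc i"] that 2 by simp
      let ?x = "b \<otimes> list_prod mid"
      have x: "?x \<in> carrier G" "?x \<notin> A" using mem prefix_mid[of "length mid"] by auto
      have xc: "list_prod bs = ?x \<otimes> c" using 2 mem by (simp add: m_assoc)
      have "side ?x = side b"
        by (rule side_path) (use mem prefix_mid in auto)
      moreover have "side (?x \<otimes> c) = (side ?x \<noteq> (c \<in> B2))"
        using side_B1[of ?x c] side_B2[of ?x c] x xc prod mem(2) by auto
      moreover have "side b = (side \<one> \<noteq> (b \<in> B2))"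
        using side_B1[of \<one> b] side_B2[of \<one> b] mem one_A by auto
      moreover have "side (?x \<otimes> c) = side \<one>"
        using side_B1[of \<one> "?x \<otimes> c"] prod xc x mem by simp
      ultimately have type: "b \<in> B2 \<longleftrightarrow> c \<in> B2" by auto
      then have "common c b" using mem unfolding common_def by auto
      have "mid \<noteq> []"
        using alt 2 \<open>common c b\<close> unfolding common_def by auto
      have mid_alt: "alternating mid"
        using alt 2 unfolding alternating_def by (auto simp: successively_append_iff successively_Cons)
      define a where "a = list_prod bs"
      have a: "a \<in> A" "a \<in> carrier G" "inv a \<in> A"
        using prod subgroup_A by (auto simp: a_def dest: subgroup.mem_carrier subgroup.m_inv_closed)
      define d where "d = c \<otimes> (inv a \<otimes> b)"
      have d_G: "d \<in> carrier G" using mem a by (auto simp: d_def)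
      have d_type: "d \<in> B2 \<longleftrightarrow> c \<in> B2" if "d \<notin> A"
        using that mem a type subgroups unfolding d_def
        by (metis DiffE IntI Int_iff UnE subgroup.m_closed)
      have d_S: "d \<in> S"
        using mem a type subgroups unfolding d_def
        by (metis DiffE IntI Int_iff UnE UnI1 UnI2 subgroup.m_closed)
      have "list_prod mid \<otimes> d = \<one>"
      proof -
        have "a = b \<otimes> (list_prod mid \<otimes> c)" using 2 mem by (simp add: a_def)
        then have "inv b \<otimes> a = list_prod mid \<otimes> c"
          using mem by (simp add: inv_mult_cancel)
        then have "list_prod mid \<otimes> d = inv b \<otimes> a \<otimes> (inv a \<otimes> b)"
          using mem a by (simp add: d_def m_assoc)
        also have "\<dots> = \<one>" using mem a by (simp add: m_assoc inv_mult_cancel)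
        finally show ?thesis .
      qed
      show False
      proof (cases "d \<in> A")
        case True
        have "list_prod mid \<in> A"
          using subgroup_mult_right_iff[OF subgroup_A, of "list_prod mid" d] True one_A mem \<open>list_prod mid \<otimes> d = \<one>\<close>
          by auto
        moreover have "list_prod mid \<notin> A"
          by (rule less.hyps) (use mid_alt \<open>mid \<noteq> []\<close> 2 in auto)
        ultimately show False by simp
      next
        case False
        have "\<not> common (last mid) c"
          using alt 2 \<open>mid \<noteq> []\<close> by (auto simp: successively_append_iff successively_Cons)
        then have "\<not> common (last mid) d"
          using d_type[OF False] False d_S mem(2) unfolding common_def by auto
        then have "alternating (mid @ [d])"
          using mid_alt d_S False unfolding alternating_def
          by (auto simp: successively_append_iff)
        then have "list_prod (mid @ [d]) \<notin> A"
          by (rule less.hyps[rotated]) (use 2 in auto)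
        moreover have "list_prod (mid @ [d]) = \<one>"
          using \<open>list_prod mid \<otimes> d = \<one>\<close> mem d_G by simp
        ultimately show False using one_A by simp
      qed
    qed
  qed
qed

end

section \<open>Saturated sets of edges\<close>

context sided_group
begin

inductive walk :: "('q \<times> 'a \<times> 'q) set \<Rightarrow> 'q \<Rightarrow> 'a list \<Rightarrow> 'q \<Rightarrow> bool" for T where
  Nil: "walk T u [] u"
| Cons: "(u, x, v) \<in> T \<Longrightarrow> walk T v xs w \<Longrightarrow> walk T u (x # xs) w"

lemma walk_append: "walk T u xs v \<Longrightarrow> walk T v ys w \<Longrightarrow> walk T u (xs @ ys) w"
  by (induction rule: walk.induct) (auto intro: walk.intros)

inductive_cases walk_NilE: "walk T u [] v"
inductive_cases walk_ConsE: "walk T u (x # xs) v"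

lemma walk_appendE:
  assumes "walk T u (xs @ ys) w"
  obtains v where "walk T u xs v" "walk T v ys w"
  using assms
proof (induction xs arbitrary: u thesis)
  case Nil
  then show ?case by (auto intro: walk.Nil)
next
  case (Cons x xs)
  from Cons.prems(2) obtain v where v: "(u, x, v) \<in> T" "walk T v (xs @ ys) w"
    by (auto elim: walk_ConsE)
  obtain v' where "walk T v xs v'" "walk T v' ys w"
    using Cons.IH[OF _ v(2)] by blast
  with v(1) show ?case using Cons.prems(1) by (auto intro: walk.Cons)
qed

definition saturated :: "('q \<times> 'a \<times> 'q) set \<Rightarrow> bool" where
  "saturated T \<longleftrightarrow> (\<forall>u x v y w. (u, x, v) \<in> T \<longrightarrow> (v, y, w) \<in> T \<longrightarrow>
     common x y \<longrightarrow> (u, x \<otimes> y, w) \<in> T)"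

text \<open>
  If no two consecutive labels of the walk had a common factor, then none of them would lie in
  \<open>A\<close>, because an element of \<open>A\<close> has a common factor with each of its neighbours. The walk would
  spell an alternating word with product \<open>\<one>\<close>, against the normal form theorem. So two
  consecutive edges can be replaced by one.
\<close>

lemma saturated_walk:
  assumes "saturated T" "walk T u xs v" "set xs \<subseteq> S" "xs \<noteq> []" "list_prod xs = \<one>"
  shows "(u, \<one>, v) \<in> T"
  using assms(2-)
proof (induction "length xs" arbitrary: xs rule: less_induct)
  case less
  have G: "set xs \<subseteq> carrier G" using less.prems(2) S_carrier by auto
  have "\<exists>ys a b zs. xs = ys @ a # b # zs \<and> common a b" if "length xs > 1"
  proof (rule ccontr)
    assume none: "\<not> ?thesis"
    then have succ: "successively (\<lambda>a b. \<not> common a b) xs"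
    proof (induction xs)
      case (Cons x xs)
      then have "successively (\<lambda>a b. \<not> common a b) xs" by (metis append_Cons)
      moreover have "\<not> common x (hd xs)" if "xs \<noteq> []"
        using Cons.prems that by (metis append_Nil list.collapse)
      ultimately show ?case by (auto simp: successively_Cons)
    qed simp
    have "x \<notin> A" if mem: "x \<in> set xs" for x
    proof
      assume x: "x \<in> A"
      obtain ys zs where split: "xs = ys @ x # zs" using split_list[OF mem] by blast
      show False
      proof (cases zs)
        case (Cons b zs')
        then show False using none split x less.prems(2) common_A[of x b] by auto
      next
        case Nil
        then obtain ys' b where "ys = ys' @ [b]"
          using split \<open>length xs > 1\<close> by (cases ys rule: rev_cases) auto
        then have "xs = ys' @ b # x # []" "common b x"
          using split Nil x less.prems(2) common_A[of x b] by auto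
        then show False using none by blast
      qed
    qed
    then have "alternating xs" using succ less.prems(2) unfolding alternating_def by auto
    then show False using alternating_list_prod less.prems(3,4) one_A by fastforce
  qed
  then consider "length xs = 1" | ys a b zs where "xs = ys @ a # b # zs" "common a b"
    using less.prems(3) by (cases xs) auto
  then show ?case
  proof cases
    case 1
    then obtain x where "xs = [x]" by (auto simp: length_Suc_conv)
    then show ?thesis using less.prems G by (auto elim!: walk_ConsE walk_NilE)
  next
    case (2 ys a b zs)
    obtain p where p: "walk T u ys p" "walk T p (a # b # zs) v"
      using less.prems(1) 2(1) by (auto elim: walk_appendE)
    then obtain q r where "(p, a, q) \<in> T" "(q, b, r) \<in> T" and r: "walk T r zs v"
      by (auto elim!: walk_ConsE)
    then have "(p, a \<otimes> b, r) \<in> T"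
      using assms(1) 2 unfolding saturated_def by blast
    then have "walk T u (ys @ (a \<otimes> b) # zs) v"
      using walk_append[OF p(1) walk.Cons[OF _ r]] by blast
    moreover have "list_prod (ys @ (a \<otimes> b) # zs) = \<one>"
      using less.prems(4) 2(1) G by (simp add: m_assoc)
    moreover have "set (ys @ (a \<otimes> b) # zs) \<subseteq> S"
      using less.prems(2) 2 common_mult by auto
    ultimately show ?thesis
      using less.hyps[of "ys @ (a \<otimes> b) # zs"] 2(1) by simp
  qed
qed

end

section \<open>Bounded conjugators\<close>

context group
begin

definition conjugate :: "'a \<Rightarrow> 'a set \<Rightarrow> 'a set" where
  "conjugate g H = (\<lambda>h. g \<otimes> h \<otimes> inv g) ` H"

lemma conjugate_subgroups_iff:
  assumes "H \<subseteq> carrier G"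
  shows "conjugate_subgroups G H K \<longleftrightarrow> (\<exists>g\<in>carrier G. conjugate g H = K)"
proof -
  have "g <# (H #> inv g) = conjugate g H" if "g \<in> carrier G" for g
    using assms that by (auto simp: l_coset_def r_coset_def conjugate_def m_assoc subset_iff)
  then show ?thesis unfolding conjugate_subgroups_def by metis
qed

lemma conjugate_conjugate:
  assumes "x \<in> carrier G" "y \<in> carrier G" "H \<subseteq> carrier G"
  shows "conjugate x (conjugate y H) = conjugate (x \<otimes> y) H"
proof -
  have "x \<otimes> (y \<otimes> h \<otimes> inv y) \<otimes> inv x = x \<otimes> y \<otimes> h \<otimes> inv (x \<otimes> y)" if "h \<in> H" for h
    using that assms by (auto simp: inv_mult_group m_assoc subset_iff)
  then show ?thesis unfolding conjugate_def by (simp add: image_image)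
qed

lemma conjugate_one: "H \<subseteq> carrier G \<Longrightarrow> conjugate \<one> H = H"
  unfolding conjugate_def by (force simp: subset_iff image_iff)

lemma conjugate_closed: "x \<in> carrier G \<Longrightarrow> H \<subseteq> carrier G \<Longrightarrow> conjugate x H \<subseteq> carrier G"
  unfolding conjugate_def by auto

lemma conjugate_eq_iff:
  assumes "x \<in> carrier G" "H \<subseteq> carrier G" "K \<subseteq> carrier G"
  shows "conjugate x H = K \<longleftrightarrow> H = conjugate (inv x) K"
  using assms by (auto simp: conjugate_conjugate conjugate_one)

lemma conjugate_subgroup_self:
  assumes "subgroup H G" "k \<in> H"
  shows "conjugate k H = H"
proof
  interpret H: subgroup H G by fact
  show sub: "conjugate k H \<subseteq> H"
    unfolding conjugate_def using assms(2) by auto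
  have "conjugate (inv k) H \<subseteq> H"
    unfolding conjugate_def using assms(2) by auto
  then have "conjugate k (conjugate (inv k) H) \<subseteq> conjugate k H"
    unfolding conjugate_def by blast
  then show "H \<subseteq> conjugate k H"
    using assms(2) conjugate_conjugate[of k "inv k" H] conjugate_one[OF H.subset] H.subset
    by simp
qed

end

context sided_group
begin

text \<open>
  What is used of a connected set of elements: it is not separated by an edge of the tree
  that it avoids.
\<close>

definition tight :: "'a set \<Rightarrow> bool" where
  "tight Y \<longleftrightarrow> Y \<subseteq> carrier G \<and> (\<forall>z\<in>carrier G. (\<forall>y\<in>Y. inv z \<otimes> y \<notin> A) \<longrightarrow>
     (\<forall>y\<in>Y. \<forall>y'\<in>Y. side (inv z \<otimes> y) = side (inv z \<otimes> y')))"

lemma tight_translate: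
  assumes "tight Y" "g \<in> carrier G"
  shows "tight ((\<otimes>) g ` Y)"
  unfolding tight_def
proof (intro conjI ballI impI)
  have Y: "Y \<subseteq> carrier G" using assms(1) unfolding tight_def by blast
  then show "(\<otimes>) g ` Y \<subseteq> carrier G" using assms(2) by auto
  fix z u u'
  assume z: "z \<in> carrier G" and off: "\<forall>y\<in>(\<otimes>) g ` Y. inv z \<otimes> y \<notin> A"
    and u: "u \<in> (\<otimes>) g ` Y" "u' \<in> (\<otimes>) g ` Y"
  have shift: "inv z \<otimes> (g \<otimes> y) = inv (inv g \<otimes> z) \<otimes> y" if "y \<in> Y" for y
  proof -
    have "y \<in> carrier G" using Y that by blast
    then show ?thesis using assms(2) z by (simp add: inv_mult_group m_assoc)
  qed
  have z': "inv g \<otimes> z \<in> carrier G" using assms(2) z by simp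
  have "\<forall>y\<in>Y. inv (inv g \<otimes> z) \<otimes> y \<notin> A"
  proof
    fix y assume y: "y \<in> Y"
    show "inv (inv g \<otimes> z) \<otimes> y \<notin> A"
      using bspec[OF off imageI[OF y]] unfolding shift[OF y] .
  qed
  with assms(1) z' have "\<forall>y\<in>Y. \<forall>y'\<in>Y.
      side (inv (inv g \<otimes> z) \<otimes> y) = side (inv (inv g \<otimes> z) \<otimes> y')"
    unfolding tight_def by blast
  then have eq: "side (inv z \<otimes> (g \<otimes> y)) = side (inv z \<otimes> (g \<otimes> y'))"
    if "y \<in> Y" "y' \<in> Y" for y y'
    unfolding shift[OF that(1)] shift[OF that(2)] using that by blast
  show "side (inv z \<otimes> u) = side (inv z \<otimes> u')"
    using u by (elim imageE, hypsubst) (rule eq)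
qed

text \<open>
  Take a shortest path from \<open>Y\<close> to \<open>Y'\<close> with steps in \<open>S\<close>, say with at least two steps, and
  let \<open>z\<close> be its second point. By minimality the coset \<open>zA\<close> meets neither \<open>Y\<close> nor \<open>Y'\<close>, and
  the path visits it only once, so the edge \<open>zA\<close> separates \<open>Y\<close> from \<open>Y'\<close>. The translate of the
  path by \<open>k \<in> K\<close> also leads from \<open>Y\<close> to \<open>Y'\<close>, hence it visits \<open>zA\<close>. It does so at its
  second point \<open>kz\<close>: a visit at a later point would give a shortcut through \<open>z\<close>.
  Thus \<open>kzA = zA\<close>.
\<close>

lemma tight_near_or_fixed:
  assumes Y: "tight Y" "Y \<noteq> {}" and Y': "tight Y'" "Y' \<noteq> {}"
    and K: "K \<subseteq> carrier G"
      "\<And>k y. k \<in> K \<Longrightarrow> y \<in> Y \<Longrightarrow> k \<otimes> y \<in> Y"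
      "\<And>k y. k \<in> K \<Longrightarrow> y \<in> Y' \<Longrightarrow> k \<otimes> y \<in> Y'"
    and generators: "carrier G = list_prod ` lists S"
  shows "(\<exists>y\<in>Y. \<exists>b\<in>S. y \<otimes> b \<in> Y') \<or>
    (\<exists>y\<in>Y. \<exists>b\<in>S. \<forall>k\<in>K. inv (y \<otimes> b) \<otimes> (k \<otimes> (y \<otimes> b)) \<in> A)"
proof -
  have sub: "Y \<subseteq> carrier G" "Y' \<subseteq> carrier G" using Y Y' unfolding tight_def by auto
  define joins where "joins y bs \<longleftrightarrow> y \<in> Y \<and> set bs \<subseteq> S \<and> y \<otimes> list_prod bs \<in> Y'" for y bs
  have "\<exists>y bs. joins y bs"
  proof -
    obtain y y' where yy': "y \<in> Y" "y' \<in> Y'" using Y Y' by blast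
    then have "inv y \<otimes> y' \<in> carrier G" using sub by auto
    then obtain bs where "set bs \<subseteq> S" "list_prod bs = inv y \<otimes> y'"
      unfolding generators by (auto simp: lists_eq_set)
    then have "joins y bs"
      using yy' sub by (auto simp: joins_def inv_mult_cancel subset_iff)
    then show ?thesis by blast
  qed
  then obtain y bs where bs: "joins y bs"
    and min: "\<And>y' bs'. joins y' bs' \<Longrightarrow> length bs \<le> length bs'"
    using ex_has_least_nat[of "\<lambda>(y, bs). joins y bs" _ "\<lambda>(y, bs). length bs"] by fastforce
  have y: "y \<in> Y" "y \<in> carrier G" and bsS: "set bs \<subseteq> S" "set bs \<subseteq> carrier G"
    and end_Y': "y \<otimes> list_prod bs \<in> Y'"
    using bs sub S_carrier unfolding joins_def by auto
  consider "bs = []" | b where "bs = [b]" | b c ds where "bs = b # c # ds"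
    by (metis neq_Nil_conv)
  then show ?thesis
  proof cases
    case 1
    then have "y \<otimes> \<one> \<in> Y'" using end_Y' by simp
    then show ?thesis using y one_A by blast
  next
    case (2 b)
    then have "y \<otimes> b \<in> Y'" "b \<in> S" using end_Y' bsS by auto
    then show ?thesis using y by blast
  next
    case (3 b c ds)
    have bc: "b \<in> S" "c \<in> S" "b \<in> carrier G" "c \<in> carrier G" "set ds \<subseteq> S" "set ds \<subseteq> carrier G"
      using 3 bsS by auto
    define z where "z = y \<otimes> b"
    define pt where "pt l = y \<otimes> list_prod (take l bs)" for l
    have z: "z \<in> carrier G" using y bc by (simp add: z_def)
    have A_carrier: "a \<in> carrier G \<and> inv a \<in> A" if "a \<in> A" for a
      using that subgroup_A by (auto dest: subgroup.mem_carrier subgroup.m_inv_closed)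
    have pt_carrier: "pt l \<in> carrier G" for l
      using y bsS unfolding pt_def by (meson list_prod_closed m_closed order_trans set_take_subset)
    have shift: "u = z \<otimes> (inv z \<otimes> u)" if "u \<in> carrier G" for u
      using that z by (simp add: inv_mult_cancel)
    have not_common: "\<not> common b c"
    proof
      assume "common b c"
      then have "joins y ((b \<otimes> c) # ds)"
        using y end_Y' 3 bc common_mult unfolding joins_def by (auto simp: m_assoc)
      then show False using min 3 by fastforce
    qed
    \<comment> \<open>A point of \<open>Y\<close> in \<open>zA\<close> would allow to drop the first step of the path.\<close>
    have off_Y: "inv z \<otimes> u \<notin> A" if u: "u \<in> Y" for u
    proof
      assume a: "inv z \<otimes> u \<in> A"
      let ?a = "inv z \<otimes> u"
      have "u \<in> carrier G" using u sub by blast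
      then have "u \<otimes> inv ?a = z" using z by (simp add: inv_mult_group inv_mult_cancel)
      moreover have "u \<otimes> (inv ?a \<otimes> c \<otimes> list_prod ds) = u \<otimes> inv ?a \<otimes> c \<otimes> list_prod ds"
        using A_carrier[OF a] bc u sub by (auto simp: m_assoc subset_iff)
      ultimately have "joins u ((inv ?a \<otimes> c) # ds)"
        using end_Y' u 3 bc A_mult_S(1)[of "inv ?a" c] A_carrier[OF a] y
        unfolding joins_def z_def by (auto simp: m_assoc)
      then show False using min 3 by fastforce
    qed
    \<comment> \<open>Every point of \<open>zA\<close> is a single step away from \<open>y\<close>, so a path that meets \<open>zA\<close> only after more than one step is not shortest.\<close>
    have short: "l \<le> 1" if u: "u \<in> carrier G" "inv z \<otimes> u \<in> A" and l: "l \<le> length bs"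
      and rest: "u \<otimes> list_prod (drop l bs) \<in> Y'" for u l
    proof -
      let ?a = "inv z \<otimes> u"
      have "set (drop l bs) \<subseteq> S" using bsS set_drop_subset by fastforce
      moreover have "set (drop l bs) \<subseteq> carrier G" using bsS set_drop_subset by fastforce
      moreover from this have "y \<otimes> list_prod ((b \<otimes> ?a) # drop l bs) = u \<otimes> list_prod (drop l bs)"
        using y bc u(1) by (simp add: z_def inv_mult_group m_assoc inv_mult_cancel)
      ultimately have "joins y ((b \<otimes> ?a) # drop l bs)"
        using rest y(1) bc(1) u(2) A_mult_S(2)[of ?a b]
        unfolding joins_def by (simp del: list_prod_Cons)
      then show ?thesis using min[of y "(b \<otimes> ?a) # drop l bs"] l by simp
    qed
    have off_Y': "inv z \<otimes> u \<notin> A" if u: "u \<in> Y'" for u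
    proof
      assume "inv z \<otimes> u \<in> A"
      then have "length bs \<le> 1" using short[of u "length bs"] u sub by auto
      then show False using 3 by simp
    qed
    have split_pt: "pt l \<otimes> list_prod (drop l bs) = y \<otimes> list_prod bs" for l
    proof -
      have "set (take l bs) \<subseteq> carrier G" "set (drop l bs) \<subseteq> carrier G"
        using bsS set_take_subset set_drop_subset by fastforce+
      then show ?thesis
        using y list_prod_append[of "take l bs" "drop l bs"] unfolding pt_def
        by (simp add: m_assoc del: list_prod_append)
    qed
    have off_pt: "inv z \<otimes> pt l \<notin> A" if "2 \<le> l" "l \<le> length bs" for l
      using short[OF pt_carrier, of l l] that end_Y' split_pt by fastforce
    let ?\<sigma> = "\<lambda>u. side (inv z \<otimes> u)"
    have pt2: "pt 2 = z \<otimes> c" "pt 2 \<in> carrier G"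
      using 3 y bc pt_carrier by (simp_all add: pt_def z_def m_assoc numeral_2_eq_2)
    have "?\<sigma> (y \<otimes> list_prod bs) = ?\<sigma> (pt 2)"
    proof -
      have "side (inv z \<otimes> pt 2 \<otimes> list_prod ds) = side (inv z \<otimes> pt 2)"
      proof (rule side_path)
        show "inv z \<otimes> pt 2 \<otimes> list_prod (take i ds) \<notin> A" if "i \<le> length ds" for i
        proof -
          have "set (take i ds) \<subseteq> carrier G" using bc set_take_subset by fastforce
          then have "inv z \<otimes> pt 2 \<otimes> list_prod (take i ds) = inv z \<otimes> pt (Suc (Suc i))"
            using 3 y bc z pt2 by (simp add: pt_def z_def m_assoc)
          then show ?thesis using off_pt[of "Suc (Suc i)"] that 3 by simp
        qed
      qed (use z pt2 bc in auto)
      moreover have "y \<otimes> list_prod bs = pt 2 \<otimes> list_prod ds"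
        using split_pt[of 2] 3 by (simp add: numeral_2_eq_2)
      ultimately show ?thesis using z pt2 bc by (simp add: m_assoc)
    qed
    moreover have "?\<sigma> y \<noteq> ?\<sigma> (pt 2)"
    proof -
      have pt2': "inv z \<otimes> pt 2 = c" using pt2 z bc by (simp add: inv_mult_cancel)
      have "c \<notin> A" using off_pt[of 2] 3 pt2' by simp
      moreover have y': "inv z \<otimes> y = inv b"
        using y bc by (simp add: z_def inv_mult_group m_assoc)
      moreover have "inv b \<notin> A" using off_Y[OF y(1)] y' by simp
      moreover have "side (inv b \<otimes> b) = (if b \<in> B1 then side (inv b) else \<not> side (inv b))"
        using side_B1[of "inv b" b] side_B2[of "inv b" b] bc one_A \<open>inv b \<notin> A\<close> by auto
      moreover have "side (\<one> \<otimes> c) = (if c \<in> B1 then side \<one> else \<not> side \<one>)"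
        using side_B1[of \<one> c] side_B2[of \<one> c] bc one_A \<open>c \<notin> A\<close> by auto
      moreover have "b \<in> B1 \<longleftrightarrow> c \<notin> B1"
        using not_common bc unfolding common_def by auto
      ultimately show ?thesis using bc pt2' by (auto split: if_splits)
    qed
    ultimately have separated: "?\<sigma> y \<noteq> ?\<sigma> (y \<otimes> list_prod bs)" by simp
    have fixed: "inv z \<otimes> (k \<otimes> z) \<in> A" if k: "k \<in> K" for k
    proof -
      have kG: "k \<in> carrier G" using k K by auto
      have mult_pt: "inv z \<otimes> (k \<otimes> y) \<otimes> list_prod (take l bs) = inv z \<otimes> (k \<otimes> pt l)" for l
      proof -
        have "set (take l bs) \<subseteq> carrier G" using bsS set_take_subset by fastforce
        then show ?thesis using z kG y by (simp add: pt_def m_assoc)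
      qed
      have "?\<sigma> (k \<otimes> y) = ?\<sigma> y"
        using Y(1) off_Y z K(2)[OF k y(1)] y(1) unfolding tight_def by blast
      moreover have "?\<sigma> (k \<otimes> (y \<otimes> list_prod bs)) = ?\<sigma> (y \<otimes> list_prod bs)"
        using Y'(1) off_Y' z K(3)[OF k end_Y'] end_Y' unfolding tight_def by blast
      moreover have "k \<otimes> (y \<otimes> list_prod bs) = k \<otimes> pt (length bs)" by (simp add: pt_def)
      ultimately have "side (inv z \<otimes> (k \<otimes> y) \<otimes> list_prod bs) \<noteq> side (inv z \<otimes> (k \<otimes> y))"
        using separated mult_pt[of "length bs"] by simp
      then obtain l where l: "l \<le> length bs" "inv z \<otimes> (k \<otimes> pt l) \<in> A"
        using side_path[of "inv z \<otimes> (k \<otimes> y)" bs] bsS z kG y mult_pt by auto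
      have "set (drop l bs) \<subseteq> carrier G" using bsS set_drop_subset by fastforce
      then have "k \<otimes> pt l \<otimes> list_prod (drop l bs) \<in> Y'"
        using K(3)[OF k end_Y'] kG pt_carrier by (simp add: m_assoc split_pt)
      then have "l \<le> 1" using short[of "k \<otimes> pt l" l] l kG pt_carrier by blast
      moreover have "l \<noteq> 0"
        using l(2) off_Y[OF K(2)[OF k y(1)]] y by (metis list_prod_Nil pt_def r_one take0)
      ultimately have "l = 1" by simp
      then show ?thesis using l(2) 3 bc by (simp add: pt_def z_def)
    qed
    then show ?thesis using y bc unfolding z_def by blast
  qed
qed

definition span :: "'a list list \<Rightarrow> 'a set" where
  "span ks = generate G (list_prod ` set ks)"

text \<open>
  The union of all translates by \<open>span ks\<close> of the paths that start at \<open>\<one>\<close> and read the words \<open>ks\<close>.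
\<close>

definition flower :: "'a list list \<Rightarrow> 'a set" where
  "flower ks = {k \<otimes> list_prod (take i w) |k w i. k \<in> span ks \<and> w \<in> set ks}"

lemma subgroup_span: "set ks \<subseteq> lists S \<Longrightarrow> subgroup (span ks) G"
  unfolding span_def using S_carrier
  by (intro generate_is_subgroup) (auto simp: lists_eq_set intro!: list_prod_closed)

lemma span_closed: "set ks \<subseteq> lists S \<Longrightarrow> span ks \<subseteq> carrier G"
  using subgroup_span subgroup.subset by blast

lemma take_closed: "w \<in> lists S \<Longrightarrow> list_prod (take i w) \<in> carrier G"
  using S_carrier by (intro list_prod_closed) (auto simp: lists_eq_set dest!: in_set_takeD)

lemma flower_left_mult:
  assumes "set ks \<subseteq> lists S" "k \<in> span ks" "y \<in> flower ks"
  shows "k \<otimes> y \<in> flower ks"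
proof -
  obtain k' w i where y: "y = k' \<otimes> list_prod (take i w)" "k' \<in> span ks" "w \<in> set ks"
    using assms(3) unfolding flower_def by blast
  interpret subgroup "span ks" G using assms(1) by (rule subgroup_span)
  have "w \<in> lists S" using y assms(1) by blast
  then have "k \<otimes> y = k \<otimes> k' \<otimes> list_prod (take i w)"
    using assms(2) y take_closed[of w i] by (simp add: m_assoc)
  then show ?thesis using y assms(2) unfolding flower_def by blast
qed

text \<open>
  An edge that avoids the flower cannot be crossed while a word of \<open>ks\<close> is read from a point of
  \<open>span ks\<close>. So \<open>side\<close> agrees on \<open>k\<close> and on all \<open>kh\<close> with a generator \<open>h\<close>, and therefore on all of
  \<open>span ks\<close>.
\<close>

lemma tight_flower:
  assumes ks: "set ks \<subseteq> lists S"
  shows "tight (flower ks)"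
proof -
  interpret subgroup "span ks" G using ks by (rule subgroup_span)
  have "side (inv z \<otimes> y) = side (inv z \<otimes> \<one>)"
    if z: "z \<in> carrier G" and off: "\<forall>y\<in>flower ks. inv z \<otimes> y \<notin> A" and y: "y \<in> flower ks" for z y
  proof -
    have petal: "side (inv z \<otimes> (k \<otimes> list_prod (take i w))) = side (inv z \<otimes> k)"
      if k: "k \<in> span ks" and w: "w \<in> set ks" for k w i
    proof -
      have wS: "w \<in> lists S" using w ks by blast
      have "side (inv z \<otimes> k \<otimes> list_prod (take i w)) = side (inv z \<otimes> k)"
      proof (rule side_path)
        show "set (take i w) \<subseteq> S" using ks w by (auto simp: lists_eq_set dest!: in_set_takeD)
        show "inv z \<otimes> k \<otimes> list_prod (take j (take i w)) \<notin> A" for j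
        proof -
          have "k \<otimes> list_prod (take (min j i) w) \<in> flower ks"
            using k w unfolding flower_def by blast
          then have "inv z \<otimes> (k \<otimes> list_prod (take (min j i) w)) \<notin> A" using off by blast
          then show ?thesis
            using z k take_closed[OF wS, of "min j i"] by (simp add: m_assoc)
        qed
      qed (use z k in auto)
      then show ?thesis using z k take_closed[OF wS, of i] by (simp add: m_assoc)
    qed
    have "\<forall>k\<in>span ks. side (inv z \<otimes> (k \<otimes> h)) = side (inv z \<otimes> k)" if "h \<in> span ks" for h
      using that[unfolded span_def]
    proof (induction rule: generate.induct)
      case one
      show ?case by simp
    next
      case (incl h)
      then obtain w where "w \<in> set ks" "h = list_prod w" by blast
      then show ?case using petal[of _ w "length w"] by simp
    next
      case (inv h)
      then obtain w where w: "w \<in> set ks" "h = list_prod w" by blast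
      then have h: "h \<in> span ks" unfolding span_def by (auto intro: generate.incl)
      show ?case
      proof
        fix k assume k: "k \<in> span ks"
        have "k \<otimes> inv h \<in> span ks" using k h by blast
        from petal[OF this w(1), of "length w"]
        show "side (inv z \<otimes> (k \<otimes> inv h)) = side (inv z \<otimes> k)"
          using w k h by (simp add: m_assoc)
      qed
    next
      case (eng h1 h2)
      have h: "h1 \<in> span ks" "h2 \<in> span ks" using eng.hyps by (simp_all add: span_def)
      show ?case
      proof
        fix k assume k: "k \<in> span ks"
        have "side (inv z \<otimes> (k \<otimes> h1 \<otimes> h2)) = side (inv z \<otimes> (k \<otimes> h1))"
          using eng.IH(2) k h by blast
        then show "side (inv z \<otimes> (k \<otimes> (h1 \<otimes> h2))) = side (inv z \<otimes> k)"
          using eng.IH(1) k h by (simp add: m_assoc)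
      qed
    qed
    from this[of k for k] have "side (inv z \<otimes> k) = side (inv z \<otimes> \<one>)" if "k \<in> span ks" for k
      using that by (metis l_one mem_carrier one_closed)
    then show ?thesis using y petal unfolding flower_def by blast
  qed
  moreover have "flower ks \<subseteq> carrier G"
  proof
    fix y assume "y \<in> flower ks"
    then obtain k w i where "y = k \<otimes> list_prod (take i w)" "k \<in> span ks" "w \<in> set ks"
      unfolding flower_def by blast
    moreover from this have "w \<in> lists S" using ks by blast
    ultimately show "y \<in> carrier G" using take_closed[of w i] by simp
  qed
  ultimately show ?thesis unfolding tight_def by metis
qed

end

context group
begin

lemma list_prod_inverse:
  "set xs \<subseteq> carrier G \<Longrightarrow> list_prod (rev (map (\<lambda>x. inv x) xs)) = inv (list_prod xs)"
proof (induction xs)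
  case (Cons x xs)
  have "set (rev (map (\<lambda>x. inv x) xs)) \<subseteq> carrier G" using Cons.prems by auto
  then show ?case using Cons by (simp add: inv_mult_group)
qed simp

end

context sided_group
begin

definition prefix_values :: "'a list list \<Rightarrow> 'a set" where
  "prefix_values ks = {list_prod (take i w) |w i. w \<in> set ks}"

lemma prefix_values_closed: "set ks \<subseteq> lists S \<Longrightarrow> u \<in> prefix_values ks \<Longrightarrow> u \<in> carrier G"
  unfolding prefix_values_def using take_closed by blast

lemma flower_prefix: "flower ks = {k \<otimes> u |k u. k \<in> span ks \<and> u \<in> prefix_values ks}"
  unfolding flower_def prefix_values_def by blast

lemma conjugator_near_or_fixed:
  assumes generators: "carrier G = list_prod ` lists S"
    and hs: "set hs \<subseteq> lists S" "hs \<noteq> []" and ks: "set ks \<subseteq> lists S" "ks \<noteq> []"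
    and g: "g \<in> carrier G" "conjugate g (span hs) = span ks"
  shows "(\<exists>u\<in>prefix_values ks. \<exists>v\<in>prefix_values hs. \<exists>b\<in>S.
      conjugate (u \<otimes> b \<otimes> inv v) (span hs) = span ks) \<or>
    (\<exists>u\<in>prefix_values ks. \<exists>b\<in>S. conjugate (inv (u \<otimes> b)) (span ks) \<subseteq> A)"
proof -
  interpret K: subgroup "span ks" G using ks(1) by (rule subgroup_span)
  interpret H: subgroup "span hs" G using hs(1) by (rule subgroup_span)
  have nonempty: "flower ws \<noteq> {}" if "ws \<noteq> []" for ws
    using that generate.one[of G] unfolding flower_def span_def by (cases ws) auto
  have flower_closed: "flower ws \<subseteq> carrier G" if "set ws \<subseteq> lists S" for ws
    using tight_flower[OF that] unfolding tight_def by blast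
  let ?Y' = "(\<otimes>) g ` flower hs"
  have "(\<exists>y\<in>flower ks. \<exists>b\<in>S. y \<otimes> b \<in> ?Y') \<or>
    (\<exists>y\<in>flower ks. \<exists>b\<in>S. \<forall>k\<in>span ks. inv (y \<otimes> b) \<otimes> (k \<otimes> (y \<otimes> b)) \<in> A)"
  proof (rule tight_near_or_fixed)
    show "tight (flower ks)" "tight ?Y'"
      using ks hs g by (auto intro: tight_flower tight_translate)
    show "flower ks \<noteq> {}" "?Y' \<noteq> {}" using nonempty ks hs by auto
    show "k \<otimes> y \<in> flower ks" if "k \<in> span ks" "y \<in> flower ks" for k y
      using flower_left_mult[OF ks(1) that] .
    show "k \<otimes> y \<in> ?Y'" if k: "k \<in> span ks" and y: "y \<in> ?Y'" for k y
    proof -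
      obtain h where h: "h \<in> span hs" "k = g \<otimes> h \<otimes> inv g"
        using k g(2) unfolding conjugate_def by blast
      obtain x where x: "x \<in> flower hs" "y = g \<otimes> x" using y by blast
      have "x \<in> carrier G" using x flower_closed[OF hs(1)] by blast
      then have "k \<otimes> y = g \<otimes> (h \<otimes> x)"
        using h x g(1) by (simp add: m_assoc inv_mult_cancel)
      then show ?thesis using flower_left_mult[OF hs(1) h(1) x(1)] by blast
    qed
  qed (use generators in auto)
  then show ?thesis
  proof (elim disjE bexE)
    fix y b assume y: "y \<in> flower ks" and b: "b \<in> S" and "y \<otimes> b \<in> ?Y'"
    then obtain k u h v where
      ku: "y = k \<otimes> u" "k \<in> span ks" "u \<in> prefix_values ks" and
      hv: "y \<otimes> b = g \<otimes> (h \<otimes> v)" "h \<in> span hs" "v \<in> prefix_values hs"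
      unfolding flower_prefix by blast
    have G: "u \<in> carrier G" "v \<in> carrier G" "b \<in> carrier G" "k \<in> carrier G" "h \<in> carrier G"
      using ku hv ks hs b S_carrier prefix_values_closed by auto
    have "u \<otimes> b \<otimes> inv v = inv k \<otimes> (k \<otimes> u \<otimes> b) \<otimes> inv v"
      using G by (simp add: m_assoc inv_mult_cancel)
    also have "\<dots> = inv k \<otimes> (g \<otimes> h)"
      using hv(1) ku(1) G g(1) by (simp add: m_assoc)
    finally have eq: "u \<otimes> b \<otimes> inv v = inv k \<otimes> (g \<otimes> h)" .
    have "conjugate (inv k \<otimes> (g \<otimes> h)) (span hs) =
        conjugate (inv k) (conjugate g (conjugate h (span hs)))"
      using G g(1) H.subset by (simp add: conjugate_conjugate conjugate_closed)
    also have "\<dots> = span ks"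
      using conjugate_subgroup_self[OF H.subgroup_axioms hv(2)]
        conjugate_subgroup_self[OF K.subgroup_axioms K.m_inv_closed[OF ku(2)]] g(2) by simp
    finally have "conjugate (u \<otimes> b \<otimes> inv v) (span hs) = span ks" unfolding eq .
    then show ?thesis using ku(3) hv(3) b by blast
  next
    fix y b assume y: "y \<in> flower ks" and b: "b \<in> S"
      and fixed: "\<forall>k\<in>span ks. inv (y \<otimes> b) \<otimes> (k \<otimes> (y \<otimes> b)) \<in> A"
    obtain k u where ku: "y = k \<otimes> u" "k \<in> span ks" "u \<in> prefix_values ks"
      using y unfolding flower_prefix by blast
    have G: "u \<in> carrier G" "b \<in> carrier G" "k \<in> carrier G"
      using ku ks b S_carrier prefix_values_closed by auto
    have "inv (u \<otimes> b) \<otimes> x \<otimes> inv (inv (u \<otimes> b)) \<in> A" if x: "x \<in> span ks" for x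
    proof -
      have "k \<otimes> x \<otimes> inv k \<in> span ks" using ku x by blast
      then have "inv (y \<otimes> b) \<otimes> (k \<otimes> x \<otimes> inv k \<otimes> (y \<otimes> b)) \<in> A" using fixed by blast
      moreover have "inv (y \<otimes> b) \<otimes> (k \<otimes> x \<otimes> inv k \<otimes> (y \<otimes> b)) =
          inv (u \<otimes> b) \<otimes> x \<otimes> inv (inv (u \<otimes> b))"
        using G x ku(1) by (simp add: m_assoc inv_mult_group inv_mult_cancel)
      ultimately show ?thesis by simp
    qed
    then have "conjugate (inv (u \<otimes> b)) (span ks) \<subseteq> A" unfolding conjugate_def by blast
    then show ?thesis using ku b by blast
  qed
qed

text \<open>
  The finite set \<open>D\<close> contains \<open>S\<close> for the case that the two flowers come close to each other, and
  the elements \<open>bcb'\<close> for the case that both groups are conjugate into \<open>A\<close>, where \<open>c\<close> runs through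
  one chosen conjugator for each pair of conjugate subsets of \<open>A\<close>.
\<close>

theorem bounded_conjugators:
  assumes generators: "carrier G = list_prod ` lists S" and "finite S"
  shows "\<exists>D. finite D \<and> D \<subseteq> carrier G \<and>
    (\<forall>hs ks. set hs \<subseteq> lists S \<and> hs \<noteq> [] \<longrightarrow> set ks \<subseteq> lists S \<and> ks \<noteq> [] \<longrightarrow>
      (\<exists>g\<in>carrier G. conjugate g (span hs) = span ks) \<longrightarrow>
      (\<exists>u\<in>prefix_values ks. \<exists>v\<in>prefix_values hs. \<exists>d\<in>D.
        conjugate (u \<otimes> d \<otimes> inv v) (span hs) = span ks))"
proof -
  define c where "c P Q = (SOME x. x \<in> carrier G \<and> conjugate x Q = P)" for P Q
  define D where "D = S \<union> (\<lambda>(b, P, Q, b'). b \<otimes> c P Q \<otimes> b') ` (S \<times> Pow A \<times> Pow A \<times> S) \<inter> carrier G"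
  show ?thesis
  proof (intro exI conjI allI impI)
    show "finite D" using \<open>finite S\<close> by (simp add: D_def)
    show "D \<subseteq> carrier G" using S_carrier by (auto simp: D_def)
    fix hs ks
    assume "set hs \<subseteq> lists S \<and> hs \<noteq> []" "set ks \<subseteq> lists S \<and> ks \<noteq> []"
    then have hs: "set hs \<subseteq> lists S" "hs \<noteq> []" and ks: "set ks \<subseteq> lists S" "ks \<noteq> []" by blast+
    assume "\<exists>g\<in>carrier G. conjugate g (span hs) = span ks"
    then obtain g where g: "g \<in> carrier G" "conjugate g (span hs) = span ks" by blast
    have sub: "span hs \<subseteq> carrier G" "span ks \<subseteq> carrier G" using hs ks span_closed by auto
    have g': "inv g \<in> carrier G" "conjugate (inv g) (span ks) = span hs"
      using g conjugate_eq_iff[of g "span hs" "span ks"] sub by auto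
    note near = conjugator_near_or_fixed[OF generators hs ks g]
      conjugator_near_or_fixed[OF generators ks hs g']
    consider
        (forward) u v b where "u \<in> prefix_values ks" "v \<in> prefix_values hs" "b \<in> S"
          "conjugate (u \<otimes> b \<otimes> inv v) (span hs) = span ks"
      | (backward) u v b where "u \<in> prefix_values hs" "v \<in> prefix_values ks" "b \<in> S"
          "conjugate (u \<otimes> b \<otimes> inv v) (span ks) = span hs"
      | (elliptic) u b v b' where "u \<in> prefix_values ks" "b \<in> S"
          "conjugate (inv (u \<otimes> b)) (span ks) \<subseteq> A"
          "v \<in> prefix_values hs" "b' \<in> S" "conjugate (inv (v \<otimes> b')) (span hs) \<subseteq> A"
      using near by blast
    then show "\<exists>u\<in>prefix_values ks. \<exists>v\<in>prefix_values hs. \<exists>d\<in>D.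
        conjugate (u \<otimes> d \<otimes> inv v) (span hs) = span ks"
    proof cases
      case forward
      then show ?thesis unfolding D_def by blast
    next
      case backward
      have G: "u \<in> carrier G" "v \<in> carrier G" "b \<in> carrier G"
        using backward hs ks S_carrier prefix_values_closed by auto
      have "span ks = conjugate (inv (u \<otimes> b \<otimes> inv v)) (span hs)"
        using backward(4) G sub conjugate_eq_iff[of "u \<otimes> b \<otimes> inv v" "span ks" "span hs"] by simp
      moreover have "inv (u \<otimes> b \<otimes> inv v) = v \<otimes> inv b \<otimes> inv u"
        using G by (simp add: inv_mult_group m_assoc)
      moreover have "inv b \<in> D" using inv_S backward(3) unfolding D_def by blast
      ultimately show ?thesis using backward by metis
    next
      case elliptic
      have G: "u \<in> carrier G" "v \<in> carrier G" "b \<in> carrier G" "b' \<in> carrier G"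
        using elliptic hs ks S_carrier prefix_values_closed by auto
      define P where "P = conjugate (inv (u \<otimes> b)) (span ks)"
      define Q where "Q = conjugate (inv (v \<otimes> b')) (span hs)"
      have K: "span ks = conjugate (u \<otimes> b) P"
        unfolding P_def using G sub by (simp add: conjugate_conjugate conjugate_one)
      have H: "span hs = conjugate (v \<otimes> b') Q"
        unfolding Q_def using G sub by (simp add: conjugate_conjugate conjugate_one)
      have PQ: "P \<subseteq> carrier G" "Q \<subseteq> carrier G"
        unfolding P_def Q_def
        by (rule conjugate_closed[OF inv_closed[OF m_closed[OF G(1,3)]] sub(2)])
          (rule conjugate_closed[OF inv_closed[OF m_closed[OF G(2,4)]] sub(1)])
      have "conjugate (inv (u \<otimes> b) \<otimes> g \<otimes> (v \<otimes> b')) Q = P"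
      proof -
        have "conjugate (inv (u \<otimes> b) \<otimes> g \<otimes> (v \<otimes> b')) Q =
            conjugate (inv (u \<otimes> b)) (conjugate g (conjugate (v \<otimes> b') Q))"
          using G PQ g(1) by (simp add: conjugate_conjugate conjugate_closed m_assoc)
        then show ?thesis unfolding H[symmetric] g(2) P_def .
      qed
      moreover have "inv (u \<otimes> b) \<otimes> g \<otimes> (v \<otimes> b') \<in> carrier G" using G g(1) by simp
      ultimately have "\<exists>x. x \<in> carrier G \<and> conjugate x Q = P" by blast
      then have "c P Q \<in> carrier G \<and> conjugate (c P Q) Q = P"
        unfolding c_def by (rule someI_ex)
      then have c: "c P Q \<in> carrier G" "conjugate (c P Q) Q = P" by simp_all
      define d where "d = b \<otimes> c P Q \<otimes> inv b'"
      have "d \<in> (\<lambda>(b, P, Q, b'). b \<otimes> c P Q \<otimes> b') ` (S \<times> Pow A \<times> Pow A \<times> S)"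
        unfolding d_def
        using elliptic(2,3,6) inv_S[OF elliptic(5)] unfolding P_def[symmetric] Q_def[symmetric]
        by (intro image_eqI[of _ _ "(b, P, Q, inv b')"]) simp_all
      moreover have d: "d \<in> carrier G" using c G by (simp add: d_def)
      ultimately have "d \<in> D" unfolding D_def by blast
      moreover have "conjugate (u \<otimes> d \<otimes> inv v) (span hs) = span ks"
      proof -
        have "u \<otimes> d \<otimes> inv v \<otimes> (v \<otimes> b') = u \<otimes> b \<otimes> c P Q"
          using G c by (simp add: d_def m_assoc inv_mult_cancel)
        then have "conjugate (u \<otimes> d \<otimes> inv v) (span hs) = conjugate (u \<otimes> b \<otimes> c P Q) Q"
          using H G PQ c d by (simp add: conjugate_conjugate)
        also have "\<dots> = span ks"
          using K c G PQ conjugate_conjugate[of "u \<otimes> b" "c P Q" Q] by simp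
        finally show ?thesis .
      qed
      ultimately show ?thesis using elliptic by blast
    qed
  qed
qed

end

section \<open>Membership in finitely generated subgroups\<close>

context sided_group
begin

text \<open>
  The point \<open>(n, i)\<close> is the end of the prefix of length \<open>i\<close> of the \<open>n\<close>-th word of \<open>ks @ [w]\<close>.
  All beginnings are joined to the base point \<open>(0, 0)\<close> by edges with label \<open>\<one>\<close>, and so are the
  ends of the words \<open>ks\<close>, but not the end of \<open>w\<close>.
\<close>

inductive_set edges :: "'a list list \<Rightarrow> 'a list \<Rightarrow> ((nat \<times> nat) \<times> 'a \<times> nat \<times> nat) set"
  for ks w where
  letter: "n \<le> length ks \<Longrightarrow> i < length ((ks @ [w]) ! n) \<Longrightarrow>
    ((n, i), (ks @ [w]) ! n ! i, (n, Suc i)) \<in> edges ks w"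
| letter_inv: "n \<le> length ks \<Longrightarrow> i < length ((ks @ [w]) ! n) \<Longrightarrow>
    ((n, Suc i), inv ((ks @ [w]) ! n ! i), (n, i)) \<in> edges ks w"
| leave: "n \<le> length ks \<Longrightarrow> ((0, 0), \<one>, (n, 0)) \<in> edges ks w"
| arrive: "n \<le> length ks \<Longrightarrow> ((n, 0), \<one>, (0, 0)) \<in> edges ks w"
| close: "n < length ks \<Longrightarrow> ((n, length (ks ! n)), \<one>, (0, 0)) \<in> edges ks w"
| close_inv: "n < length ks \<Longrightarrow> ((0, 0), \<one>, (n, length (ks ! n))) \<in> edges ks w"

lemma edges_walks:
  assumes "n \<le> length ks"
  shows "walk (edges ks w) (n, 0) ((ks @ [w]) ! n) (n, length ((ks @ [w]) ! n))" (is ?forward)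
    and "walk (edges ks w) (n, length ((ks @ [w]) ! n)) (rev (map (\<lambda>x. inv x) ((ks @ [w]) ! n))) (n, 0)"
      (is ?backward)
proof -
  let ?w = "(ks @ [w]) ! n" and ?E = "edges ks w"
  have "walk ?E (n, 0) (take i ?w) (n, i) \<and>
      walk ?E (n, i) (rev (map (\<lambda>x. inv x) (take i ?w))) (n, 0)" if "i \<le> length ?w" for i
    using that
  proof (induction i)
    case 0
    show ?case by (simp add: walk.Nil)
  next
    case (Suc i)
    then have i: "i < length ?w" and IH: "walk ?E (n, 0) (take i ?w) (n, i)"
      "walk ?E (n, i) (rev (map (\<lambda>x. inv x) (take i ?w))) (n, 0)" by auto
    have "walk ?E (n, i) [?w ! i] (n, Suc i)"
      by (rule walk.Cons[OF edges.letter[OF assms i] walk.Nil])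
    from walk_append[OF IH(1) this] walk.Cons[OF edges.letter_inv[OF assms i] IH(2)]
    show ?case using i by (simp add: take_Suc_conv_app_nth)
  qed
  from this[of "length ?w"] show ?forward ?backward by simp_all
qed

lemma walk_mono: "walk T u xs v \<Longrightarrow> T \<subseteq> T' \<Longrightarrow> walk T' u xs v"
  by (induction rule: walk.induct) (auto intro: walk.intros)

lemma span_loop:
  assumes ks: "set ks \<subseteq> lists S" and "h \<in> span ks"
  shows "\<exists>xs. set xs \<subseteq> S \<and> walk (edges ks w) (0, 0) xs (0, 0) \<and> list_prod xs = h"
  using assms(2)[unfolded span_def]
proof (induction rule: generate.induct)
  case one
  show ?case by (rule exI[of _ "[]"]) (simp add: walk.Nil)
next
  case (incl h)
  then obtain n where n: "n < length ks" "h = list_prod (ks ! n)"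
    by (auto simp: in_set_conv_nth)
  then have "ks ! n \<in> lists S" using ks nth_mem[OF n(1)] by blast
  then have S: "set (ks ! n) \<subseteq> S" by (simp add: lists_eq_set)
  have kn: "(ks @ [w]) ! n = ks ! n" using n by (simp add: nth_append)
  have "walk (edges ks w) (0, 0) (\<one> # ks ! n @ [\<one>]) (0, 0)"
    using edges_walks(1)[of n ks w] n kn
    by (auto intro!: walk.Cons[OF edges.leave[of n]] walk_append walk.Cons[OF edges.close] walk.Nil)
  moreover have "list_prod (\<one> # ks ! n @ [\<one>]) = h"
    using n S S_carrier by (simp add: subset_trans)
  ultimately show ?case using S one_A by (intro exI[of _ "\<one> # ks ! n @ [\<one>]"]) auto
next
  case (inv h)
  then obtain n where n: "n < length ks" "h = list_prod (ks ! n)"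
    by (auto simp: in_set_conv_nth)
  then have "ks ! n \<in> lists S" using ks nth_mem[OF n(1)] by blast
  then have S: "set (ks ! n) \<subseteq> S" by (simp add: lists_eq_set)
  have kn: "(ks @ [w]) ! n = ks ! n" using n by (simp add: nth_append)
  let ?ys = "rev (map (\<lambda>x. inv x) (ks ! n))"
  have ys: "set ?ys \<subseteq> S" using S inv_S by auto
  have "walk (edges ks w) (n, length (ks ! n)) ?ys (n, 0)"
    using edges_walks(2)[of n ks w] n(1) kn by simp
  then have "walk (edges ks w) (0, 0) (\<one> # ?ys @ [\<one>]) (0, 0)"
    by (rule walk.Cons[OF edges.close_inv[OF n(1)]
          walk_append[OF _ walk.Cons[OF edges.arrive walk.Nil]]]) (use n(1) in simp)
  moreover have "list_prod (\<one> # ?ys @ [\<one>]) = inv h"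
    using n S S_carrier list_prod_inverse[of "ks ! n"] list_prod_append[of ?ys "[\<one>]"]
      list_prod_closed[of "ks ! n"] ys
    by (simp add: subset_trans del: list_prod_append)
  ultimately show ?case using ys one_A by (intro exI[of _ "\<one> # ?ys @ [\<one>]"]) auto
next
  case (eng h1 h2)
  then obtain xs ys where "set xs \<subseteq> S" "walk (edges ks w) (0, 0) xs (0, 0)" "list_prod xs = h1"
    "set ys \<subseteq> S" "walk (edges ks w) (0, 0) ys (0, 0)" "list_prod ys = h2" by blast
  then show ?case
    using S_carrier walk_append by (intro exI[of _ "xs @ ys"]) (auto simp: subset_trans)
qed

text \<open>
  From the end of \<open>w\<close> read \<open>w\<close> backwards and then a product of loops with value \<open>w\<close>. This is a
  walk with product \<open>\<one>\<close>.
\<close>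

lemma saturated_if_member:
  assumes ks: "set ks \<subseteq> lists S" and w: "w \<in> lists S" and member: "list_prod w \<in> span ks"
    and T: "saturated T" "edges ks w \<subseteq> T"
  shows "((length ks, length w), \<one>, (0, 0)) \<in> T"
proof -
  obtain xs where xs: "set xs \<subseteq> S" "walk (edges ks w) (0, 0) xs (0, 0)" "list_prod xs = list_prod w"
    using span_loop[OF ks member] by blast
  let ?back = "rev (map (\<lambda>x. inv x) w)"
  have S: "set w \<subseteq> S" "set ?back \<subseteq> S" using w inv_S by (auto simp: lists_eq_set)
  have G: "set w \<subseteq> carrier G" "set ?back \<subseteq> carrier G" "set xs \<subseteq> carrier G"
    using S xs S_carrier by (blast intro: subset_trans)+
  have "walk (edges ks w) (length ks, length w) (?back @ \<one> # xs) (0, 0)"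
    using edges_walks(2)[of "length ks" ks w] xs(2)
    by (auto intro!: walk_append walk.Cons[OF edges.arrive])
  then have "walk T (length ks, length w) (?back @ \<one> # xs) (0, 0)"
    using T(2) by (rule walk_mono)
  moreover have "list_prod (?back @ \<one> # xs) = \<one>"
    using G xs(3) list_prod_append[OF G(2), of "\<one> # xs"] list_prod_inverse[OF G(1)]
    by (simp del: list_prod_append)
  ultimately show ?thesis
    using T(1) S xs(1) one_A by (intro saturated_walk[of T _ "?back @ \<one> # xs"]) auto
qed

text \<open>
  The largest set of edges that is true in \<open>G\<close>: with \<open>K = span ks\<close> and with \<open>u\<close> and \<open>v\<close> the values
  of the prefixes that end at the two points, an edge labelled \<open>x\<close> stands for the equation
  \<open>Kux = Kv\<close>.
\<close>

definition coset_triples ::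
  "'a list list \<Rightarrow> 'a list \<Rightarrow> ((nat \<times> nat) \<times> 'a \<times> nat \<times> nat) set" where
  "coset_triples ks w = {((n, i), x, (m, j)) |n i x m j. n \<le> length ks \<and> m \<le> length ks \<and>
     i \<le> length ((ks @ [w]) ! n) \<and> j \<le> length ((ks @ [w]) ! m) \<and> x \<in> S \<and>
     list_prod (take i ((ks @ [w]) ! n)) \<otimes> x \<otimes> inv list_prod (take j ((ks @ [w]) ! m)) \<in> span ks}"

lemma coset_triples:
  assumes ks: "set ks \<subseteq> lists S" and w: "w \<in> lists S"
  shows "saturated (coset_triples ks w)" "edges ks w \<subseteq> coset_triples ks w"
    and "((length ks, length w), \<one>, (0, 0)) \<in> coset_triples ks w \<Longrightarrow> list_prod w \<in> span ks"
proof -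
  interpret K: subgroup "span ks" G using ks by (rule subgroup_span)
  define val where "val n i = list_prod (take i ((ks @ [w]) ! n))" for n i
  have words: "(ks @ [w]) ! n \<in> lists S" if "n \<le> length ks" for n
  proof (cases "n = length ks")
    case True
    then show ?thesis using w by simp
  next
    case False
    then have "n < length ks" using that by simp
    moreover from this have "ks ! n \<in> lists S" using ks nth_mem by blast
    ultimately show ?thesis by (simp add: nth_append)
  qed
  have val: "val n i \<in> carrier G" if "n \<le> length ks" for n i
    unfolding val_def using words[OF that] by (rule take_closed)
  have val_Suc: "val n (Suc i) = val n i \<otimes> (ks @ [w]) ! n ! i"
      "(ks @ [w]) ! n ! i \<in> S"
    if "n \<le> length ks" "i < length ((ks @ [w]) ! n)" for n i
  proof -
    let ?w = "(ks @ [w]) ! n"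
    have w: "set ?w \<subseteq> S" using words[OF that(1)] by (simp add: lists_eq_set)
    then show "?w ! i \<in> S" using that by (meson nth_mem subsetD)
    then have "?w ! i \<in> carrier G" "set (take i ?w) \<subseteq> carrier G"
      using w S_carrier by (auto dest!: in_set_takeD)
    then show "val n (Suc i) = val n i \<otimes> ?w ! i"
      using that by (simp add: val_def take_Suc_conv_app_nth)
  qed
  have mem: "((n, i), x, (m, j)) \<in> coset_triples ks w \<longleftrightarrow> n \<le> length ks \<and> m \<le> length ks \<and>
     i \<le> length ((ks @ [w]) ! n) \<and> j \<le> length ((ks @ [w]) ! m) \<and> x \<in> S \<and>
     val n i \<otimes> x \<otimes> inv val m j \<in> span ks" for n i x m j
    unfolding coset_triples_def val_def by blast
  show "saturated (coset_triples ks w)"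
    unfolding saturated_def
  proof (intro allI impI)
    fix u x v y t
    assume "(u, x, v) \<in> coset_triples ks w" "(v, y, t) \<in> coset_triples ks w" and common: "common x y"
    moreover obtain n i m j r l where u: "u = (n, i)" "v = (m, j)" "t = (r, l)"
      by (metis surj_pair)
    ultimately have 1: "((n, i), x, (m, j)) \<in> coset_triples ks w"
      "((m, j), y, (r, l)) \<in> coset_triples ks w" by auto
    then have G: "val n i \<in> carrier G" "val m j \<in> carrier G" "val r l \<in> carrier G"
      "x \<in> carrier G" "y \<in> carrier G"
      unfolding mem using val S_carrier by auto
    have "val n i \<otimes> x \<otimes> inv val m j \<otimes> (val m j \<otimes> y \<otimes> inv val r l) \<in> span ks"
      using 1 unfolding mem by blast
    moreover have "val n i \<otimes> x \<otimes> inv val m j \<otimes> (val m j \<otimes> y \<otimes> inv val r l) =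
        val n i \<otimes> (x \<otimes> y) \<otimes> inv val r l"
      using G by (simp add: m_assoc inv_mult_cancel)
    ultimately show "(u, x \<otimes> y, t) \<in> coset_triples ks w"
      unfolding u mem using 1[unfolded mem] common_mult[OF common] by simp
  qed
  have val_0: "val n 0 = \<one>" for n by (simp add: val_def)
  have val_end: "val n (length (ks ! n)) \<in> span ks" if "n < length ks" for n
    using that by (auto simp: val_def nth_append span_def intro!: generate.incl)
  show "edges ks w \<subseteq> coset_triples ks w"
  proof -
    have "((p, q), x, (r, s)) \<in> coset_triples ks w" if "((p, q), x, (r, s)) \<in> edges ks w"
      for p q x r s
      using that
    proof (induction rule: edges.induct)
      case (letter n i)
      have "(ks @ [w]) ! n ! i \<in> carrier G" using val_Suc(2)[OF letter] S_carrier by blast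
      then show ?case unfolding mem
        using letter val_Suc[OF letter] val[OF letter(1), of i] by simp
    next
      case (letter_inv n i)
      have "(ks @ [w]) ! n ! i \<in> carrier G" using val_Suc(2)[OF letter_inv] S_carrier by blast
      then show ?case unfolding mem
        using letter_inv val_Suc[OF letter_inv] val[OF letter_inv(1), of i]
          inv_S[OF val_Suc(2)[OF letter_inv]]
        by (simp add: m_assoc)
    next
      case (close n)
      then show ?case unfolding mem
        using val_end[of n] val[of n] one_A by (auto simp: val_0 nth_append)
    next
      case (close_inv n)
      then show ?case unfolding mem
        using val_end[of n] val[of n] one_A by (auto simp: val_0 nth_append)
    qed (use one_A in \<open>auto simp: mem val_0\<close>)
    then show ?thesis by (auto simp: subset_iff)
  qed
  show "list_prod w \<in> span ks" if "((length ks, length w), \<one>, (0, 0)) \<in> coset_triples ks w"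
    using that val[of "length ks" "length w"] unfolding mem by (simp add: val_0) (simp add: val_def)
qed

end

section \<open>The side function of a presentation in two parts\<close>

lemma words_append: "u \<in> words X \<Longrightarrow> v \<in> words X \<Longrightarrow> u @ v \<in> words X"
  by (simp add: words_def)

lemma words_mono: "X \<subseteq> X' \<Longrightarrow> words X \<subseteq> words X'"
  by (auto simp: words_def)

lemma words_Cons: "l # w \<in> words X \<longleftrightarrow> fst l \<in> X \<and> w \<in> words X"
  by (cases l) (simp add: words_def)

lemma Nil_words: "[] \<in> words X"
  by (simp add: words_def)

lemma pres_eq_mono:
  assumes "pres_eq X R u v" "X \<subseteq> X'" "R \<subseteq> R'"
  shows "pres_eq X' R' u v"
  using assms(1)
proof (induction rule: pres_eq.induct)
  case (refl u)
  then show ?case using words_mono[OF assms(2)] by (auto intro: pres_eq.refl)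
next
  case (sym u v)
  show ?case by (rule pres_eq.sym[OF sym.IH])
next
  case (trans u v w)
  show ?case by (rule pres_eq.trans[OF trans.IH])
next
  case (append u u' v v')
  show ?case by (rule pres_eq.append[OF append.IH])
next
  case (cancel x b)
  then show ?case using assms(2) by (auto intro: pres_eq.cancel)
next
  case (relation u v)
  then show ?case using words_mono[OF assms(2)] assms(3) by (auto intro: pres_eq.relation)
qed

lemma word_class_eq: "pres_eq X R u v \<Longrightarrow> word_class X R u = word_class X R v"
  using word_class_eq_iff[of u X R v] pres_eq_words[of X R u v] by simp

lemma finite_image_classes:
  assumes "finite (carrier (presented_group X R))" "X \<subseteq> X'" "R \<subseteq> R'"
  shows "finite (word_class X' R' ` words X)"
proof -
  let ?rep = "\<lambda>U. word_class X' R' (SOME v. v \<in> U)"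
  have rep: "word_class X' R' u = ?rep (word_class X R u)" if "u \<in> words X" for u
  proof -
    have "u \<in> word_class X R u" using that by (simp add: word_class_def pres_eq.refl)
    then have "(SOME v. v \<in> word_class X R u) \<in> word_class X R u" by (rule someI)
    then have "pres_eq X R u (SOME v. v \<in> word_class X R u)" by (simp only: word_class_def mem_Collect_eq)
    from word_class_eq[OF pres_eq_mono[OF this assms(2,3)]] show ?thesis .
  qed
  have "word_class X' R' ` words X \<subseteq> ?rep ` carrier (presented_group X R)"
  proof (rule image_subsetI)
    fix u assume u: "u \<in> words X"
    then have "word_class X R u \<in> carrier (presented_group X R)" by (simp add: presented_group_def)
    then show "word_class X' R' u \<in> ?rep ` carrier (presented_group X R)"
      unfolding rep[OF u] by (rule imageI)
  qed
  then show ?thesis using assms(1) by (meson finite_imageI finite_subset)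
qed

text \<open>
  The last alternative covers the relations that identify the images of an element of the
  amalgamated subgroup.
\<close>

locale two_part_presentation =
  fixes X1 X2 :: "'x set" and R :: "('x word \<times> 'x word) set"
  assumes disjoint: "X1 \<inter> X2 = {}"
    and relations: "(u, v) \<in> R \<Longrightarrow> u \<in> words X1 \<and> v \<in> words X1 \<or>
      u \<in> words X2 \<and> v \<in> words X2 \<or> u \<in> words X1 \<and> v \<in> words X2"
begin

abbreviation "X \<equiv> X1 \<union> X2"
abbreviation "G \<equiv> presented_group X R"
abbreviation "cls \<equiv> word_class X R"
abbreviation "B1 \<equiv> cls ` words X1"
abbreviation "B2 \<equiv> cls ` words X2"

sublocale group G
  by (rule group_presented_group)

lemma words_parts: "words X1 \<subseteq> words X" "words X2 \<subseteq> words X"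
  by (auto intro!: words_mono)

lemma cls_closed: "w \<in> words X \<Longrightarrow> cls w \<in> carrier G"
  by (simp add: presented_group_def)

lemma cls_append: "u \<in> words X \<Longrightarrow> v \<in> words X \<Longrightarrow> cls (u @ v) = cls u \<otimes>\<^bsub>G\<^esub> cls v"
  by (simp add: presented_group_mult)

lemma cls_Nil: "cls [] = \<one>\<^bsub>G\<^esub>"
  by (simp add: presented_group_def)

lemmas cls_eq = word_class_eq[where X = X and R = R]

lemma cls_inverse:
  "w \<in> words X \<Longrightarrow> cls (map (\<lambda>(x, b). (x, \<not> b)) (rev w)) = inv\<^bsub>G\<^esub> cls w"
proof -
  assume w: "w \<in> words X"
  let ?i = "map (\<lambda>(x, b). (x, \<not> b)) (rev w)"
  have i: "?i \<in> words X" using w by (auto simp: words_def)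
  have "cls ?i \<otimes>\<^bsub>G\<^esub> cls w = \<one>\<^bsub>G\<^esub>"
    using cls_eq[OF pres_eq_inverse[OF w]] i w by (simp add: cls_append cls_Nil)
  then show ?thesis using i w cls_closed inv_equality by metis
qed

lemma subgroup_part:
  assumes "Z \<subseteq> X"
  shows "subgroup (cls ` words Z) G"
proof (rule subgroupI)
  have Z: "words Z \<subseteq> words X" using assms by (rule words_mono)
  show "cls ` words Z \<subseteq> carrier G" using Z cls_closed by blast
  show "cls ` words Z \<noteq> {}" using Nil_words by blast
  show "inv\<^bsub>G\<^esub> a \<in> cls ` words Z" if a: "a \<in> cls ` words Z" for a
  proof -
    obtain w where w: "w \<in> words Z" "a = cls w" using a by blast
    have "map (\<lambda>(x, b). (x, \<not> b)) (rev w) \<in> words Z" using w(1) by (auto simp: words_def)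
    then have "cls (map (\<lambda>(x, b). (x, \<not> b)) (rev w)) \<in> cls ` words Z" by (rule imageI)
    moreover have "w \<in> words X" using w(1) Z by blast
    ultimately show ?thesis unfolding w(2) by (simp only: cls_inverse)
  qed
  show "a \<otimes>\<^bsub>G\<^esub> b \<in> cls ` words Z" if ab: "a \<in> cls ` words Z" "b \<in> cls ` words Z" for a b
  proof -
    obtain u v where uv: "u \<in> words Z" "v \<in> words Z" "a = cls u" "b = cls v" using ab by blast
    have "cls (u @ v) \<in> cls ` words Z" using words_append[OF uv(1,2)] by (rule imageI)
    moreover have "u \<in> words X" "v \<in> words X" using uv(1,2) Z by blast+
    ultimately show ?thesis unfolding uv(3,4) by (simp only: cls_append)
  qed
qed

abbreviation "A \<equiv> B1 \<inter> B2"

text \<open>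
  \<open>crosses u w\<close> is the total change of \<open>side\<close> along the path that starts at \<open>u\<close> and reads \<open>w\<close>,
  counted modulo \<open>2\<close>.
\<close>

fun crosses :: "'x word \<Rightarrow> 'x word \<Rightarrow> bool" where
  "crosses u [] = False"
| "crosses u (l # w) =
     ((fst l \<in> X2 \<and> (cls u \<in> A) \<noteq> (cls (u @ [l]) \<in> A)) \<noteq> crosses (u @ [l]) w)"

lemma crosses_append: "crosses u (v @ w) = (crosses u v \<noteq> crosses (u @ v) w)"
  by (induction v arbitrary: u) auto

lemma crosses_cong:
  assumes "u \<in> words X" "u' \<in> words X" "w \<in> words X" "cls u = cls u'"
  shows "crosses u w = crosses u' w"
  using assms
proof (induction w arbitrary: u u')
  case (Cons l w)
  have l: "[l] \<in> words X" "w \<in> words X"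
    using Cons.prems(3) by (simp_all add: words_Cons Nil_words)
  have eq: "cls (u @ [l]) = cls (u' @ [l])" using Cons.prems l by (simp add: cls_append)
  then have "crosses (u @ [l]) w = crosses (u' @ [l]) w"
    using Cons.prems l by (intro Cons.IH) (simp_all add: words_append)
  then show ?case using eq Cons.prems(4) by simp
qed simp

lemma crosses_part1: "w \<in> words X1 \<Longrightarrow> \<not> crosses u w"
proof (induction w arbitrary: u)
  case (Cons l w)
  then have "fst l \<notin> X2" "\<not> crosses (u @ [l]) w" using disjoint by (auto simp only: words_Cons)
  then show ?case by (simp only: crosses.simps simp_thms)
qed simp

lemma crosses_part2: "w \<in> words X2 \<Longrightarrow> crosses u w = ((cls u \<in> A) \<noteq> (cls (u @ w) \<in> A))"
proof (induction w arbitrary: u)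
  case (Cons l w)
  then have l: "fst l \<in> X2" "w \<in> words X2" by (simp_all only: words_Cons)
  have "u @ l # w = (u @ [l]) @ w" by simp
  then show ?case unfolding crosses.simps Cons.IH[OF l(2)] using l(1) by metis
qed simp

text \<open>
  The change along a word of a single factor depends only on the element that it represents:
  it is zero for \<open>X1\<close>, and for \<open>X2\<close> it depends only on whether the two ends lie in \<open>A\<close>.
  This settles the relations inside one factor. In a mixed relation the common value lies in
  \<open>A\<close>, and multiplying by it does not affect membership in \<open>A\<close>, so that the change along the word
  in \<open>X2\<close> vanishes as well.
\<close>

lemma crosses_pres_eq:
  assumes "pres_eq X R v v'" "u \<in> words X"
  shows "crosses u v = crosses u v'"
  using assms
proof (induction arbitrary: u rule: pres_eq.induct)
  case (append v v' w w')
  have mem: "v \<in> words X" "v' \<in> words X" "w \<in> words X" "w' \<in> words X"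
    using append.hyps pres_eq_words by blast+
  have "crosses (u @ v) w = crosses (u @ v') w"
    using append.prems mem cls_eq[OF append.hyps(1)]
    by (intro crosses_cong) (simp_all add: words_append cls_append)
  also have "\<dots> = crosses (u @ v') w'"
    using append.prems mem by (intro append.IH) (simp add: words_append)
  finally show ?case using append.IH(1)[OF append.prems] by (simp add: crosses_append)
next
  case (cancel x b)
  have "[(x, b), (x, \<not> b)] \<in> words X" using cancel by (simp add: words_Cons Nil_words)
  then have "cls (u @ [(x, b), (x, \<not> b)]) = cls u"
    using cls_eq[OF pres_eq.cancel[OF cancel.hyps, of R b]] cancel.prems cls_closed
    by (simp add: cls_append cls_Nil)
  then show ?case by auto
next
  case (relation v w)
  interpret A: subgroup A G
    by (intro subgroups_Inter_pair subgroup_part) auto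
  have eq: "cls v = cls w" by (intro cls_eq pres_eq.relation relation.hyps)
  have shift: "cls (u @ v) = cls (u @ w)"
    using relation by (simp add: cls_append eq)
  from relations[OF relation.hyps(1)] show ?case
  proof (elim disjE conjE)
    assume "v \<in> words X1" "w \<in> words X1"
    then show ?thesis using crosses_part1 by blast
  next
    assume "v \<in> words X2" "w \<in> words X2"
    then show ?thesis using shift by (simp add: crosses_part2)
  next
    assume v: "v \<in> words X1" and w: "w \<in> words X2"
    then have a: "cls w \<in> A" using eq by (metis IntI imageI)
    have u: "cls u \<in> carrier G" using relation.prems by (rule cls_closed)
    have "cls (u @ w) = cls u \<otimes>\<^bsub>G\<^esub> cls w" using relation by (simp only: cls_append)
    then have "cls (u @ w) \<in> A \<longleftrightarrow> cls u \<in> A"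
      using subgroup_mult_right_iff[OF A.subgroup_axioms u a] by (simp only:)
    then show ?thesis using v w by (simp add: crosses_part1 crosses_part2)
  qed
qed auto

lemma sided_group: "sided_group G B1 B2 (\<lambda>U. crosses [] (SOME u. u \<in> U))"
proof (rule sided_group.intro[OF group_axioms sided_group_axioms.intro])
  show "subgroup B1 G" "subgroup B2 G" by (auto intro: subgroup_part)
  have side_cls: "crosses [] (SOME v. v \<in> cls u) = crosses [] u" if "u \<in> words X" for u
  proof -
    have "u \<in> cls u" using that by (simp add: word_class_def pres_eq.refl)
    then have "(SOME v. v \<in> cls u) \<in> cls u" by (rule someI)
    then have "pres_eq X R u (SOME v. v \<in> cls u)" by (simp add: word_class_def)
    then show ?thesis using crosses_pres_eq Nil_words by blast
  qed
  have step: "crosses [] (SOME v. v \<in> cls u \<otimes>\<^bsub>G\<^esub> cls w) =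
      (crosses [] (SOME v. v \<in> cls u) \<noteq> crosses u w)" if "u \<in> words X" "w \<in> words X" for u w
    using that side_cls[of u] side_cls[of "u @ w"]
    by (simp add: cls_append words_append crosses_append)
  fix U b
  assume "U \<in> carrier G"
  then obtain u where u: "u \<in> words X" "U = cls u" by (auto simp: presented_group_def)
  show "crosses [] (SOME v. v \<in> U \<otimes>\<^bsub>G\<^esub> b) = crosses [] (SOME v. v \<in> U)" if b: "b \<in> B1"
  proof -
    obtain w where "w \<in> words X1" "b = cls w" using b by blast
    then show ?thesis using step[of u w] u words_parts crosses_part1 by auto
  qed
  show "crosses [] (SOME v. v \<in> U \<otimes>\<^bsub>G\<^esub> b) =
      (crosses [] (SOME v. v \<in> U) \<noteq> ((U \<in> A) \<noteq> (U \<otimes>\<^bsub>G\<^esub> b \<in> A)))" if b: "b \<in> B2"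
  proof -
    obtain w where w: "w \<in> words X2" "b = cls w" using b by blast
    then have "w \<in> words X" using words_parts by blast
    then show ?thesis
      using step[of u w] u w crosses_part2[OF w(1), of u] cls_append[of u w] by simp
  qed
qed

lemma list_prod_letters: "w \<in> words X \<Longrightarrow> list_prod (map (\<lambda>l. cls [l]) w) = cls w"
proof (induction w)
  case (Cons l w)
  then have "[l] \<in> words X" "w \<in> words X" by (simp_all add: words_Cons Nil_words)
  then show ?case using Cons.IH cls_append[of "[l]" w] by simp
qed (simp add: cls_Nil)

lemma letter_in_part: "fst l \<in> X \<Longrightarrow> cls [l] \<in> B1 \<union> B2"
  by (auto simp: words_Cons Nil_words intro!: imageI)

end

section \<open>A recursive membership test\<close>

lemma less_if_set_decode:
  assumes "n \<in> set_decode t" "t < 2 ^ b"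
  shows "n < b"
proof (rule ccontr)
  assume "\<not> n < b"
  then have "(2::nat) ^ b \<le> 2 ^ n" by (simp add: power_increasing)
  then have "t div 2 ^ n = 0" by (rule div_less[OF less_le_trans[OF assms(2)]])
  then show False using assms(1) by (simp add: set_decode_def)
qed

lemma set_encode_less:
  assumes "finite F" "\<And>n. n \<in> F \<Longrightarrow> n < b"
  shows "set_encode F < 2 ^ b"
proof -
  have "set_encode F \<le> set_encode {..<b}"
    unfolding set_encode_def using assms by (auto intro!: sum_mono2)
  also have "\<dots> < 2 ^ b"
    unfolding set_encode_def by (induction b) simp_all
  finally show ?thesis .
qed

lemma prod_encode_mono:
  assumes "a \<le> a'" "b \<le> b'"
  shows "prod_encode (a, b) \<le> prod_encode (a', b')"
proof -
  have "triangle (a + b) \<le> triangle (a' + b')"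
    unfolding triangle_def using assms by (intro div_le_mono mult_le_mono) auto
  then show ?thesis using assms(1) by (simp add: prod_encode_def)
qed

lemma nth_default_list_encode_le: "nth_default 0 xs i \<le> list_encode xs"
proof (induction xs arbitrary: i)
  case (Cons x xs)
  have "x \<le> list_encode (x # xs)" "list_encode xs \<le> list_encode (x # xs)"
    by (auto intro: le_SucI le_prod_encode_1 le_prod_encode_2)
  then show ?case using Cons by (cases i) (auto intro: order_trans)
qed simp

definition triple_code :: "nat \<Rightarrow> nat \<Rightarrow> nat \<Rightarrow> nat" where
  "triple_code a x b = prod_encode (a, prod_encode (x, b))"

lemma triple_code_eq [simp]: "triple_code a x b = triple_code a' x' b' \<longleftrightarrow> a = a' \<and> x = x' \<and> b = b'"
  by (simp add: triple_code_def)

lemma triple_code_ge: "a \<le> triple_code a x b" "x \<le> triple_code a x b" "b \<le> triple_code a x b"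
  unfolding triple_code_def
  by (meson le_prod_encode_1 le_prod_encode_2 order_trans)+

lemma triple_code_mono:
  "a \<le> a' \<Longrightarrow> x \<le> x' \<Longrightarrow> b \<le> b' \<Longrightarrow> triple_code a x b \<le> triple_code a' x' b'"
  unfolding triple_code_def by (intro prod_encode_mono)

lemma recursive_triple_code [recursive_intros]:
  "recursive f \<Longrightarrow> recursive g \<Longrightarrow> recursive h \<Longrightarrow> recursive (\<lambda>v. triple_code (f v) (g v) (h v))"
  unfolding triple_code_def by (intro recursive_intros)

text \<open>
  Letters are numbers in \<open>L\<close> with values in \<open>S\<close>, and the elements of \<open>S\<close> are numbered by
  \<open>label\<close>. Since \<open>S\<close> and \<open>L\<close> are finite, the multiplication inside the factors and the passage
  from letters to labels are finite tables.
\<close>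

locale coded_group = sided_group G B1 B2 side
  for G (structure) and B1 B2 side +
  fixes L :: "nat set" and val :: "nat \<Rightarrow> 'a" and neg :: "nat \<Rightarrow> nat" and label :: "'a \<Rightarrow> nat"
  assumes finite_S: "finite S" and finite_L: "finite L"
    and val: "z \<in> L \<Longrightarrow> val z \<in> S"
    and neg: "z \<in> L \<Longrightarrow> neg z \<in> L" "z \<in> L \<Longrightarrow> val (neg z) = inv val z"
    and generated: "carrier G = (\<lambda>zs. list_prod (map val zs)) ` lists L"
    and label: "inj_on label S"
begin

definition max_label :: nat where "max_label = (\<Sum>x\<in>S. label x)"

definition letter_label :: "nat \<Rightarrow> nat" where
  "letter_label z = (if z \<in> L then label (val z) else 0)"

definition letter_neg :: "nat \<Rightarrow> nat" where
  "letter_neg z = (if z \<in> L then neg z else 0)"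

text \<open>
  The value is shifted by one; \<open>0\<close> says that the two elements have no common factor.
\<close>

definition mult_label :: "nat \<Rightarrow> nat" where
  "mult_label z = (if \<exists>x\<in>S. \<exists>y\<in>S. common x y \<and> z = prod_encode (label x, label y)
     then Suc (label (SOME p. \<exists>x\<in>S. \<exists>y\<in>S. common x y \<and> z = prod_encode (label x, label y) \<and> p = x \<otimes> y))
     else 0)"

lemma label_le: "x \<in> S \<Longrightarrow> label x \<le> max_label"
  unfolding max_label_def using finite_S by (rule member_le_sum[rotated 2]) simp_all

lemma label_eq: "x \<in> S \<Longrightarrow> y \<in> S \<Longrightarrow> label x = label y \<longleftrightarrow> x = y"
  using label by (auto simp: inj_on_def)

lemma mult_label:
  assumes "x \<in> S" "y \<in> S"
  shows "mult_label (prod_encode (label x, label y)) = (if common x y then Suc (label (x \<otimes> y)) else 0)"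
proof -
  have "(\<exists>x'\<in>S. \<exists>y'\<in>S. common x' y' \<and> prod_encode (label x, label y) = prod_encode (label x', label y')
      \<and> P x' y') \<longleftrightarrow> common x y \<and> P x y" for P
    using assms label_eq by (simp only: prod_encode_eq prod.inject) blast
  from this[of "\<lambda>_ _. True"] this[of "\<lambda>x' y'. p = x' \<otimes> y'" for p]
  show ?thesis unfolding mult_label_def by simp
qed

lemma mult_label_nonzero:
  assumes "mult_label (prod_encode (k, l)) \<noteq> 0"
  obtains x y where "x \<in> S" "y \<in> S" "common x y" "k = label x" "l = label y"
  using assms unfolding mult_label_def by (auto split: if_splits)

lemma recursive_tables [recursive_intros]:
  "recursive f \<Longrightarrow> recursive (\<lambda>v. letter_label (f v))"
  "recursive f \<Longrightarrow> recursive (\<lambda>v. letter_neg (f v))"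
  "recursive f \<Longrightarrow> recursive (\<lambda>v. mult_label (f v))"
proof -
  have "finite {z. letter_label z \<noteq> 0}" "finite {z. letter_neg z \<noteq> 0}"
    by (rule finite_subset[OF _ finite_L]; auto simp: letter_label_def letter_neg_def)+
  moreover have "{z. mult_label z \<noteq> 0} \<subseteq> (\<lambda>(x, y). prod_encode (label x, label y)) ` (S \<times> S)"
    by (auto simp: mult_label_def split: if_splits)
  then have "finite {z. mult_label z \<noteq> 0}"
    by (rule finite_subset) (simp add: finite_S[simplified])
  ultimately show "recursive f \<Longrightarrow> recursive (\<lambda>v. letter_label (f v))"
    "recursive f \<Longrightarrow> recursive (\<lambda>v. letter_neg (f v))"
    "recursive f \<Longrightarrow> recursive (\<lambda>v. mult_label (f v))"
    by (simp_all add: recursive_finite_table)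
qed

definition petal :: "nat \<Rightarrow> nat \<Rightarrow> nat \<Rightarrow> nat" where
  "petal kc wc n = (if n < length (list_decode kc) then nth_default 0 (list_decode kc) n else wc)"

text \<open>
  An upper bound for the codes of the edges in \<open>coset_triples\<close>: numbers and lengths of words
  are bounded by the codes of the lists.
\<close>

definition triple_bound :: "nat \<Rightarrow> nat \<Rightarrow> nat" where
  "triple_bound kc wc = (let d = prod_encode (kc + wc, kc + wc) in Suc (triple_code d max_label d))"

text \<open>
  All components of a coded edge are at most its code, so the bound \<open>b\<close> on the elements of the
  set that \<open>t\<close> codes also suffices for the five quantifiers.
\<close>

definition closed_test :: "nat \<Rightarrow> nat \<Rightarrow> bool" where
  "closed_test b t \<longleftrightarrow> (\<forall>a<b. \<forall>x<b. \<forall>d<b. \<forall>y<b. \<forall>e<b.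
     triple_code a x d \<in> set_decode t \<and> triple_code d y e \<in> set_decode t \<and>
     0 < mult_label (prod_encode (x, y)) \<longrightarrow>
     triple_code a (mult_label (prod_encode (x, y)) - 1) e \<in> set_decode t)"

definition edges_test :: "nat \<Rightarrow> nat \<Rightarrow> nat \<Rightarrow> bool" where
  "edges_test kc wc t \<longleftrightarrow>
     (\<forall>n<Suc (length (list_decode kc)).
       triple_code (prod_encode (0, 0)) (label \<one>) (prod_encode (n, 0)) \<in> set_decode t \<and>
       triple_code (prod_encode (n, 0)) (label \<one>) (prod_encode (0, 0)) \<in> set_decode t \<and>
       (\<forall>i<length (list_decode (petal kc wc n)).
         triple_code (prod_encode (n, i)) (letter_label (nth_default 0 (list_decode (petal kc wc n)) i))
           (prod_encode (n, Suc i)) \<in> set_decode t \<and>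
         triple_code (prod_encode (n, Suc i))
           (letter_label (letter_neg (nth_default 0 (list_decode (petal kc wc n)) i)))
           (prod_encode (n, i)) \<in> set_decode t)) \<and>
     (\<forall>n<length (list_decode kc).
       triple_code (prod_encode (n, length (list_decode (petal kc wc n)))) (label \<one>) (prod_encode (0, 0))
         \<in> set_decode t \<and>
       triple_code (prod_encode (0, 0)) (label \<one>) (prod_encode (n, length (list_decode (petal kc wc n))))
         \<in> set_decode t)"

definition member_test :: "nat \<Rightarrow> nat \<Rightarrow> bool" where
  "member_test kc wc \<longleftrightarrow> (\<forall>t<2 ^ triple_bound kc wc.
     closed_test (triple_bound kc wc) t \<longrightarrow> edges_test kc wc t \<longrightarrow>
     triple_code (prod_encode (length (list_decode kc), length (list_decode wc))) (label \<one>)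
       (prod_encode (0, 0)) \<in> set_decode t)"

lemma recursive_petal [recursive_intros]:
  "recursive f \<Longrightarrow> recursive g \<Longrightarrow> recursive h \<Longrightarrow> recursive (\<lambda>v. petal (f v) (g v) (h v))"
  unfolding petal_def by (intro recursive_intros)

lemma recursive_triple_bound [recursive_intros]:
  "recursive f \<Longrightarrow> recursive g \<Longrightarrow> recursive (\<lambda>v. triple_bound (f v) (g v))"
  unfolding triple_bound_def Let_def by (intro recursive_intros)

lemma recursive_closed_test [recursive_intros]:
  assumes "recursive f" "recursive g"
  shows "recursive (\<lambda>v. of_bool (closed_test (f v) (g v)))"
proof (rule recursive_compose2[OF _ assms])
  show "recursive (\<lambda>v. of_bool (closed_test (arg 0 v) (arg 1 v)))"
    unfolding closed_test_def by (intro recursive_intros | simp only: arg_tl)+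
qed

lemma recursive_edges_test [recursive_intros]:
  assumes "recursive f" "recursive g" "recursive h"
  shows "recursive (\<lambda>v. of_bool (edges_test (f v) (g v) (h v)))"
proof (rule recursive_compose3[OF _ assms])
  show "recursive (\<lambda>v. of_bool (edges_test (arg 0 v) (arg 1 v) (arg 2 v)))"
    unfolding edges_test_def by (intro recursive_intros | simp only: arg_tl)+
qed

lemma recursive_member_test [recursive_intros]:
  assumes "recursive f" "recursive g"
  shows "recursive (\<lambda>v. of_bool (member_test (f v) (g v)))"
proof (rule recursive_compose2[OF _ assms])
  show "recursive (\<lambda>v. of_bool (member_test (arg 0 v) (arg 1 v)))"
    unfolding member_test_def by (intro recursive_intros | simp only: arg_tl)+
qed

end

context coded_group
begin

abbreviation code :: "(nat \<times> nat) \<times> 'a \<times> nat \<times> nat \<Rightarrow> nat" where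
  "code \<equiv> \<lambda>(u, x, v). triple_code (prod_encode u) (label x) (prod_encode v)"

definition decoded :: "nat \<Rightarrow> ((nat \<times> nat) \<times> 'a \<times> nat \<times> nat) set" where
  "decoded t = {(u, x, v). x \<in> S \<and> code (u, x, v) \<in> set_decode t}"

lemma closed_test_iff:
  assumes t: "t < 2 ^ b"
  shows "closed_test b t \<longleftrightarrow> saturated (decoded t)"
proof
  assume closed: "closed_test b t"
  show "saturated (decoded t)"
    unfolding saturated_def
  proof (intro allI impI)
    fix u x v y w
    assume "(u, x, v) \<in> decoded t" "(v, y, w) \<in> decoded t" and common: "common x y"
    then have xy: "x \<in> S" "y \<in> S" and c: "code (u, x, v) \<in> set_decode t" "code (v, y, w) \<in> set_decode t"
      unfolding decoded_def by auto
    have "code (u, x, v) < b" "code (v, y, w) < b"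
      using less_if_set_decode[OF _ t] c by blast+
    then have less: "prod_encode u < b" "label x < b" "prod_encode v < b" "label y < b" "prod_encode w < b"
      using triple_code_ge le_less_trans by (simp_all only: prod.case) blast+
    have "mult_label (prod_encode (label x, label y)) = Suc (label (x \<otimes> y))"
      using xy common by (simp only: mult_label if_True)
    then have "code (u, x \<otimes> y, w) \<in> set_decode t"
      using closed[unfolded closed_test_def, rule_format, OF less] c by simp
    then show "(u, x \<otimes> y, w) \<in> decoded t"
      unfolding decoded_def using common_mult[OF common] by simp
  qed
next
  assume sat: "saturated (decoded t)"
  show "closed_test b t"
    unfolding closed_test_def
  proof (intro allI impI, elim conjE)
    fix a k d l e
    assume c: "triple_code a k d \<in> set_decode t" "triple_code d l e \<in> set_decode t"
      and "0 < mult_label (prod_encode (k, l))"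
    then obtain x y where xy: "x \<in> S" "y \<in> S" "common x y" "k = label x" "l = label y"
      by (metis mult_label_nonzero less_numeral_extra(3))
    have "(prod_decode a, x, prod_decode d) \<in> decoded t" "(prod_decode d, y, prod_decode e) \<in> decoded t"
      using c xy by (simp_all add: decoded_def)
    then have "(prod_decode a, x \<otimes> y, prod_decode e) \<in> decoded t"
      using sat xy(3) unfolding saturated_def by blast
    moreover have "mult_label (prod_encode (k, l)) = Suc (label (x \<otimes> y))"
      using xy by (simp only: mult_label if_True)
    ultimately show "triple_code a (mult_label (prod_encode (k, l)) - 1) e \<in> set_decode t"
      by (simp add: decoded_def)
  qed
qed

abbreviation words_of :: "nat list list \<Rightarrow> 'a list list" where
  "words_of zs \<equiv> map (map val) zs"

abbreviation list_code :: "nat list list \<Rightarrow> nat" where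
  "list_code zs \<equiv> list_encode (map list_encode zs)"

lemma word_of_S: "z \<in> lists L \<Longrightarrow> map val z \<in> lists S"
  using val by (auto simp: lists_eq_set subset_iff)

lemma words_of_S: "zs \<in> lists (lists L) \<Longrightarrow> set (words_of zs) \<subseteq> lists S"
  unfolding set_map by (rule image_subsetI, rule word_of_S) (metis in_listsD)

lemma petal_list_code:
  "n \<le> length zs \<Longrightarrow> list_decode (petal (list_code zs) (list_encode z) n) = (zs @ [z]) ! n"
  unfolding petal_def by (auto simp: nth_default_def nth_append)

lemma petals:
  assumes "n \<le> length zs" "zs \<in> lists (lists L)" "z \<in> lists L"
  shows "(words_of zs @ [map val z]) ! n = map val ((zs @ [z]) ! n)" "(zs @ [z]) ! n \<in> lists L"
proof -
  have "n < length (zs @ [z])" using assms(1) by simp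
  moreover have "set (zs @ [z]) \<subseteq> lists L" using assms(2,3) by (auto simp: lists_eq_set)
  ultimately show "(zs @ [z]) ! n \<in> lists L" using nth_mem by blast
  show "(words_of zs @ [map val z]) ! n = map val ((zs @ [z]) ! n)"
    using assms(1) by (auto simp: nth_append)
qed

lemma edges_test_iff:
  assumes zs: "zs \<in> lists (lists L)" and z: "z \<in> lists L"
  shows "edges_test (list_code zs) (list_encode z) t \<longleftrightarrow>
    code ` edges (words_of zs) (map val z) \<subseteq> set_decode t"
proof -
  let ?p = "\<lambda>n. (zs @ [z]) ! n" and ?E = "edges (words_of zs) (map val z)"
  have p: "(words_of zs @ [map val z]) ! n = map val (?p n)"
      "list_decode (petal (list_code zs) (list_encode z) n) = ?p n" if "n \<le> length zs" for n
    using petals(1)[OF that zs z] petal_list_code[OF that] by auto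
  have labels: "letter_label (nth_default 0 (?p n) i) = label (val (?p n ! i))"
      "letter_label (letter_neg (nth_default 0 (?p n) i)) = label (inv val (?p n ! i))"
    if "n \<le> length zs" "i < length (?p n)" for n i
  proof -
    have "?p n ! i \<in> L" using petals(2)[OF that(1) zs z] that(2) by (auto simp: lists_eq_set)
    moreover have "nth_default 0 (?p n) i = ?p n ! i" using that(2) by (simp add: nth_default_def)
    ultimately show "letter_label (nth_default 0 (?p n) i) = label (val (?p n ! i))"
      "letter_label (letter_neg (nth_default 0 (?p n) i)) = label (inv val (?p n ! i))"
      using neg by (simp_all add: letter_label_def letter_neg_def)
  qed
  have last: "words_of zs ! n = map val (?p n)" if "n < length zs" for n
    using that by (simp add: nth_append)
  have test: "edges_test (list_code zs) (list_encode z) t \<longleftrightarrow>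
      (\<forall>n\<le>length zs. code ((0, 0), \<one>, (n, 0)) \<in> set_decode t \<and> code ((n, 0), \<one>, (0, 0)) \<in> set_decode t \<and>
        (\<forall>i<length (?p n). code ((n, i), val (?p n ! i), (n, Suc i)) \<in> set_decode t \<and>
          code ((n, Suc i), inv val (?p n ! i), (n, i)) \<in> set_decode t)) \<and>
      (\<forall>n<length zs. code ((n, length (?p n)), \<one>, (0, 0)) \<in> set_decode t \<and>
        code ((0, 0), \<one>, (n, length (?p n))) \<in> set_decode t)"
    unfolding edges_test_def less_Suc_eq_le
    using p(2) labels by (simp add: less_imp_le cong: conj_cong imp_cong)
  show ?thesis
  proof
    assume "edges_test (list_code zs) (list_encode z) t"
    note t = this[unfolded test]
    have "code ((n, i), x, (m, j)) \<in> set_decode t" if "((n, i), x, (m, j)) \<in> ?E" for n i x m j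
      using that
    proof (induction rule: edges.induct)
      case (letter n i)
      then show ?case using t p(1)[of n] by simp
    next
      case (letter_inv n i)
      then show ?case using t p(1)[of n] by simp
    next
      case (close n)
      then show ?case using t last[of n] by simp
    next
      case (close_inv n)
      then show ?case using t last[of n] by simp
    qed (use t in simp_all)
    then show "code ` ?E \<subseteq> set_decode t" by auto
  next
    assume sub: "code ` ?E \<subseteq> set_decode t"
    then have E: "code e \<in> set_decode t" if "e \<in> ?E" for e using that by blast
    show "edges_test (list_code zs) (list_encode z) t"
      unfolding test
    proof (intro conjI allI impI)
      fix n assume n: "n \<le> length zs"
      show "code ((0, 0), \<one>, (n, 0)) \<in> set_decode t" "code ((n, 0), \<one>, (0, 0)) \<in> set_decode t"
        by (rule E[OF edges.leave] E[OF edges.arrive], simp add: n)+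
      fix i assume i: "i < length (?p n)"
      show "code ((n, i), val (?p n ! i), (n, Suc i)) \<in> set_decode t"
        using E[OF edges.letter[of n "words_of zs" i "map val z"]] n i p(1)[OF n] by simp
      show "code ((n, Suc i), inv val (?p n ! i), (n, i)) \<in> set_decode t"
        using E[OF edges.letter_inv[of n "words_of zs" i "map val z"]] n i p(1)[OF n] by simp
    next
      fix n assume n: "n < length zs"
      show "code ((n, length (?p n)), \<one>, (0, 0)) \<in> set_decode t"
        using E[OF edges.close[of n "words_of zs"]] n last[OF n] by simp
      show "code ((0, 0), \<one>, (n, length (?p n))) \<in> set_decode t"
        using E[OF edges.close_inv[of n "words_of zs"]] n last[OF n] by simp
    qed
  qed
qed

lemma code_inject:
  assumes "code (u, x, v) = code (u', x', v')" "x \<in> S" "x' \<in> S"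
  shows "(u, x, v) = (u', x', v')"
  using assms label_eq by simp

lemma coset_triples_bounded:
  assumes zs: "zs \<in> lists (lists L)" and z: "z \<in> lists L"
    and e: "e \<in> coset_triples (words_of zs) (map val z)"
  shows "code e < triple_bound (list_code zs) (list_encode z)"
proof -
  let ?d = "list_code zs + list_encode z"
  obtain n i x m j where e': "e = ((n, i), x, (m, j))" "n \<le> length zs" "m \<le> length zs" "x \<in> S"
    "i \<le> length ((words_of zs @ [map val z]) ! n)" "j \<le> length ((words_of zs @ [map val z]) ! m)"
    using e unfolding coset_triples_def by auto
  have length_le: "length xs \<le> list_encode xs" for xs
    using length_list_decode_le[of "list_encode xs"] by simp
  have "length zs \<le> ?d" using length_le[of "map list_encode zs"] by simp
  moreover have len: "length ((zs @ [z]) ! n) \<le> ?d" if "n \<le> length zs" for n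
  proof (cases "n = length zs")
    case True
    then show ?thesis using length_le[of z] by simp
  next
    case False
    then have "list_encode (zs ! n) \<le> list_code zs"
      using nth_default_list_encode_le[of "map list_encode zs" n] that by (simp add: nth_default_def)
    then show ?thesis using length_le[of "zs ! n"] False that by (simp add: nth_append)
  qed
  moreover have "i \<le> length ((zs @ [z]) ! n)" "j \<le> length ((zs @ [z]) ! m)"
    using e' petals(1)[OF _ zs z] by auto
  ultimately have "prod_encode (n, i) \<le> prod_encode (?d, ?d)" "prod_encode (m, j) \<le> prod_encode (?d, ?d)"
    using e' by (meson order_trans prod_encode_mono)+
  then show ?thesis
    unfolding e'(1) triple_bound_def Let_def less_Suc_eq_le prod.case
    using label_le[OF e'(4)] by (intro triple_code_mono)
qed

lemma finite_coset_triples: "finite (coset_triples ks w)"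
proof (rule finite_subset)
  let ?P = "Sigma {..length ks} (\<lambda>n. {..length ((ks @ [w]) ! n)})"
  show "coset_triples ks w \<subseteq> ?P \<times> S \<times> ?P"
    unfolding coset_triples_def by auto
  show "finite (?P \<times> S \<times> ?P)"
    using finite_S by (intro finite_cartesian_product finite_SigmaI) simp_all
qed

text \<open>
  If the test succeeds, it applies in particular to the set of all true edges, whose code is below
  the bound. The converse holds since every saturated set of edges that contains the drawing,
  whatever its code, contains the edge in question.
\<close>

theorem member_test_iff:
  assumes zs: "zs \<in> lists (lists L)" and z: "z \<in> lists L"
  shows "member_test (list_code zs) (list_encode z) \<longleftrightarrow> list_prod (map val z) \<in> span (words_of zs)"
proof -
  let ?ks = "words_of zs" and ?w = "map val z"
  let ?B = "triple_bound (list_code zs) (list_encode z)"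
  define goal where "goal = ((length ?ks, length ?w), \<one>, (0 :: nat, 0 :: nat))"
  have ks: "set ?ks \<subseteq> lists S" and w: "?w \<in> lists S"
    using words_of_S[OF zs] word_of_S[OF z] .
  note triples = coset_triples[OF ks w]
  have test: "member_test (list_code zs) (list_encode z) \<longleftrightarrow>
      (\<forall>t<2 ^ ?B. saturated (decoded t) \<longrightarrow> code ` edges ?ks ?w \<subseteq> set_decode t \<longrightarrow> code goal \<in> set_decode t)"
    unfolding member_test_def goal_def using edges_test_iff[OF zs z]
    by (auto simp only: closed_test_iff list_encode_inverse length_map prod.case)
  have labels: "x \<in> S" if "(u, x, v) \<in> coset_triples ?ks ?w" for u x v
    using that unfolding coset_triples_def by auto
  show ?thesis
  proof
    assume "member_test (list_code zs) (list_encode z)"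
    note t = this[unfolded test, rule_format]
    let ?t = "set_encode (code ` coset_triples ?ks ?w)"
    have finite: "finite (code ` coset_triples ?ks ?w)"
      using finite_coset_triples by blast
    then have t_set: "set_decode ?t = code ` coset_triples ?ks ?w" by simp
    have "decoded ?t = coset_triples ?ks ?w"
    proof
      show "decoded ?t \<subseteq> coset_triples ?ks ?w"
      proof
        fix e assume "e \<in> decoded ?t"
        then obtain u x v e' where e: "e = (u, x, v)" "x \<in> S" "e' \<in> coset_triples ?ks ?w" "code (u, x, v) = code e'"
          unfolding decoded_def t_set by auto
        obtain u' x' v' where e': "e' = (u', x', v')" by (metis surj_pair)
        then have "x' \<in> S" using e(3) labels by blast
        then have "e = e'" using code_inject[of u x v u' x' v'] e e' by simp
        then show "e \<in> coset_triples ?ks ?w" using e by simp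
      qed
      show "coset_triples ?ks ?w \<subseteq> decoded ?t"
      proof
        fix e assume e: "e \<in> coset_triples ?ks ?w"
        obtain u x v where e': "e = (u, x, v)" by (metis surj_pair)
        then have "x \<in> S" using e labels by blast
        moreover have "code e \<in> set_decode ?t" unfolding t_set using e by (rule imageI)
        ultimately show "e \<in> decoded ?t" unfolding decoded_def e' by simp
      qed
    qed
    moreover have "?t < 2 ^ ?B"
      using finite coset_triples_bounded[OF zs z] by (intro set_encode_less) auto
    ultimately have "code goal \<in> code ` coset_triples ?ks ?w"
      using t[of ?t] triples(1,2) unfolding t_set by (simp add: image_mono)
    then obtain e where e: "e \<in> coset_triples ?ks ?w" "code goal = code e" by blast
    obtain u x v where e': "e = (u, x, v)" by (metis surj_pair)
    then have "x \<in> S" using e labels by blast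
    then have "goal = e"
      using code_inject[of "(length ?ks, length ?w)" \<one> "(0, 0)" u x v] one_A e(2)
      unfolding e' goal_def by simp
    then show "list_prod ?w \<in> span ?ks" using e(1) triples(3) unfolding goal_def by simp
  next
    assume member: "list_prod ?w \<in> span ?ks"
    show "member_test (list_code zs) (list_encode z)"
      unfolding test
    proof (intro allI impI)
      fix t assume sat: "saturated (decoded t)" and sub: "code ` edges ?ks ?w \<subseteq> set_decode t"
      have "edges ?ks ?w \<subseteq> decoded t"
      proof
        fix e assume e: "e \<in> edges ?ks ?w"
        obtain u x v where e': "e = (u, x, v)" by (metis surj_pair)
        have "x \<in> S" using e triples(2) labels unfolding e' by blast
        moreover have "code e \<in> set_decode t" using sub e by blast
        ultimately show "e \<in> decoded t" unfolding decoded_def e' by simp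
      qed
      then have "goal \<in> decoded t"
        unfolding goal_def using saturated_if_member[OF ks w member sat] by blast
      then show "code goal \<in> set_decode t" unfolding decoded_def by auto
    qed
  qed
qed

end

section \<open>A recursive conjugacy test\<close>

context group
begin

lemma conjugate_generate_subset:
  assumes "g \<in> carrier G" "X \<subseteq> carrier G" "subgroup M G"
    and X: "\<And>x. x \<in> X \<Longrightarrow> g \<otimes> x \<otimes> inv g \<in> M"
  shows "conjugate g (generate G X) \<subseteq> M"
proof -
  interpret M: subgroup M G by fact
  have "g \<otimes> x \<otimes> inv g \<in> M" if "x \<in> generate G X" for x
    using that
  proof (induction rule: generate.induct)
    case one
    show ?case using assms(1) by simp
  next
    case (incl x)
    then show ?case by (rule X)
  next
    case (inv x)
    then have "x \<in> carrier G" using assms(2) by blast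
    then have "inv (g \<otimes> x \<otimes> inv g) = g \<otimes> inv x \<otimes> inv g"
      using assms(1) by (simp add: inv_mult_group m_assoc)
    then show ?case using M.m_inv_closed[OF X[OF inv]] by simp
  next
    case (eng x y)
    then have "x \<in> carrier G" "y \<in> carrier G"
      using generate_in_carrier[OF assms(2)] by blast+
    then have "g \<otimes> x \<otimes> inv g \<otimes> (g \<otimes> y \<otimes> inv g) = g \<otimes> (x \<otimes> y) \<otimes> inv g"
      using assms(1) by (simp add: m_assoc inv_mult_cancel)
    then show ?case using M.m_closed[OF eng.IH] by simp
  qed
  then show ?thesis unfolding conjugate_def by blast
qed

end

context sided_group
begin

lemma conjugate_span_iff:
  assumes hs: "set hs \<subseteq> lists S" and ks: "set ks \<subseteq> lists S" and g: "g \<in> carrier G"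
  shows "conjugate g (span hs) = span ks \<longleftrightarrow>
    (\<forall>w\<in>set hs. g \<otimes> list_prod w \<otimes> inv g \<in> span ks) \<and>
    (\<forall>w\<in>set ks. inv g \<otimes> list_prod w \<otimes> g \<in> span hs)" (is "?lhs \<longleftrightarrow> ?rhs")
proof -
  have generators: "list_prod w \<in> carrier G \<and> list_prod w \<in> span ws"
    if "set ws \<subseteq> lists S" "w \<in> set ws" for w ws
    using span_closed[OF that(1)] generate.incl[of "list_prod w" "list_prod ` set ws" G] that(2)
    unfolding span_def by blast
  have closed: "span hs \<subseteq> carrier G" "span ks \<subseteq> carrier G"
    using hs ks span_closed by auto
  show ?thesis
  proof
    assume eq: ?lhs
    then have eq': "conjugate (inv g) (span ks) = span hs"
      using conjugate_eq_iff[OF g closed] by simp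
    have "g \<otimes> list_prod w \<otimes> inv g \<in> span ks" if "w \<in> set hs" for w
      using generators[OF hs that] unfolding eq[symmetric] conjugate_def by blast
    moreover have "inv g \<otimes> list_prod w \<otimes> g \<in> span hs" if "w \<in> set ks" for w
    proof -
      have "inv g \<otimes> list_prod w \<otimes> inv (inv g) \<in> span hs"
        using generators[OF ks that] unfolding eq'[symmetric] conjugate_def by blast
      then show ?thesis using g by simp
    qed
    ultimately show ?rhs by blast
  next
    assume rhs: ?rhs
    have "conjugate g (span hs) \<subseteq> span ks"
      unfolding span_def[of hs] using rhs generators[OF hs] g subgroup_span[OF ks]
      by (intro conjugate_generate_subset) auto
    moreover have "conjugate (inv g) (span ks) \<subseteq> span hs"
      unfolding span_def[of ks] using rhs generators[OF ks] g subgroup_span[OF hs]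
      by (intro conjugate_generate_subset) auto
    then have "conjugate g (conjugate (inv g) (span ks)) \<subseteq> conjugate g (span hs)"
      unfolding conjugate_def by blast
    then have "span ks \<subseteq> conjugate g (span hs)"
      using g closed by (simp add: conjugate_conjugate conjugate_one)
    ultimately show ?lhs by blast
  qed
qed

text \<open>
  Adding the empty word to the generators makes the list nonempty, as the bound on conjugators
  requires, and provides the word number \<open>0\<close>.
\<close>

lemma span_Nil_Cons: "set ks \<subseteq> lists S \<Longrightarrow> span ([] # ks) = span ks"
proof
  assume ks: "set ks \<subseteq> lists S"
  then have sub: "list_prod ` set ks \<subseteq> span ks" "subgroup (span ks) G"
    by (auto simp: span_def intro: generate.incl subgroup_span[unfolded span_def])
  show "span ([] # ks) \<subseteq> span ks"
    unfolding span_def[of "[] # ks"]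
    by (rule generate_subgroup_incl[OF _ sub(2)]) (use sub subgroup.one_closed in auto)
  show "span ks \<subseteq> span ([] # ks)"
    unfolding span_def by (rule mono_generate) auto
qed

end

definition append_code :: "nat \<Rightarrow> nat \<Rightarrow> nat" where
  "append_code a b = list_encode (list_decode a @ list_decode b)"

definition take_code :: "nat \<Rightarrow> nat \<Rightarrow> nat" where
  "take_code i a = list_encode (take i (list_decode a))"

lemma recursive_append_code [recursive_intros]:
  assumes "recursive f" "recursive g"
  shows "recursive (\<lambda>v. append_code (f v) (g v))"
proof (rule recursive_compose2[OF _ assms])
  have "xs @ ys = map (\<lambda>i. if i < length xs then nth_default 0 xs i else nth_default 0 ys (i - length xs))
      [0..<length xs + length ys]" for xs ys :: "nat list"
    by (rule nth_equalityI) (auto simp: nth_default_def nth_append)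
  note append = this
  show "recursive (\<lambda>v. append_code (arg 0 v) (arg 1 v))"
    unfolding append_code_def append by (intro recursive_intros | simp only: arg_tl)+
qed

lemma recursive_take_code [recursive_intros]:
  assumes "recursive f" "recursive g"
  shows "recursive (\<lambda>v. take_code (f v) (g v))"
proof (rule recursive_compose2[OF _ assms])
  have "take i xs = map (\<lambda>j. nth_default 0 xs j) [0..<if i < length xs then i else length xs]"
    for i and xs :: "nat list"
    by (rule nth_equalityI) (auto simp: nth_default_def)
  note take = this
  show "recursive (\<lambda>v. take_code (arg 0 v) (arg 1 v))"
    unfolding take_code_def take by (intro recursive_intros | simp only: arg_tl)+
qed

context coded_group
begin

definition inverse_code :: "nat \<Rightarrow> nat" where
  "inverse_code a = list_encode (rev (map letter_neg (list_decode a)))"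

lemma recursive_inverse_code [recursive_intros]:
  assumes "recursive f"
  shows "recursive (\<lambda>v. inverse_code (f v))"
proof (rule recursive_compose1[OF _ assms])
  have "rev (map letter_neg xs) =
      map (\<lambda>i. letter_neg (nth_default 0 xs (length xs - Suc i))) [0..<length xs]" for xs
    by (rule nth_equalityI) (auto simp: nth_default_def rev_nth)
  note inverse = this
  show "recursive (\<lambda>v. inverse_code (arg 0 v))"
    unfolding inverse_code_def inverse by (intro recursive_intros | simp only: arg_tl)+
qed

definition conjugator_test :: "nat \<Rightarrow> nat \<Rightarrow> nat \<Rightarrow> bool" where
  "conjugator_test g hs ks \<longleftrightarrow>
     (\<forall>n<length (list_decode hs).
       member_test ks (append_code g (append_code (nth_default 0 (list_decode hs) n) (inverse_code g)))) \<and>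
     (\<forall>n<length (list_decode ks).
       member_test hs (append_code (inverse_code g) (append_code (nth_default 0 (list_decode ks) n) g)))"

text \<open>
  \<open>Suc (prod_encode (0, ks))\<close> is the code of the list \<open>ks\<close> with the empty word in front. The list
  \<open>ds\<close> of words is a constant of the group; it represents the finite set of middle parts of
  conjugators.
\<close>

definition conjugacy_test :: "nat \<Rightarrow> nat \<Rightarrow> nat \<Rightarrow> bool" where
  "conjugacy_test ds hs ks \<longleftrightarrow>
     (\<exists>j<Suc (length (list_decode ks)). \<exists>i<Suc (length (list_decode (nth_default 0 (list_decode (Suc (prod_encode (0, ks)))) j))).
      \<exists>m<Suc (length (list_decode hs)). \<exists>l<Suc (length (list_decode (nth_default 0 (list_decode (Suc (prod_encode (0, hs)))) m))).
      \<exists>q<length (list_decode ds).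
        conjugator_test
          (append_code (take_code i (nth_default 0 (list_decode (Suc (prod_encode (0, ks)))) j))
            (append_code (nth_default 0 (list_decode ds) q)
              (inverse_code (take_code l (nth_default 0 (list_decode (Suc (prod_encode (0, hs)))) m)))))
          hs ks)"

lemma recursive_conjugator_test [recursive_intros]:
  assumes "recursive f" "recursive g" "recursive h"
  shows "recursive (\<lambda>v. of_bool (conjugator_test (f v) (g v) (h v)))"
proof (rule recursive_compose3[OF _ assms])
  show "recursive (\<lambda>v. of_bool (conjugator_test (arg 0 v) (arg 1 v) (arg 2 v)))"
    unfolding conjugator_test_def by (intro recursive_intros | simp only: arg_tl)+
qed

lemma recursive_conjugacy_test:
  "recursive (\<lambda>v. of_bool (conjugacy_test ds (arg 0 v) (arg 1 v)))"
  unfolding conjugacy_test_def by (intro recursive_intros | simp only: arg_tl)+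

lemma word_closed: "z \<in> lists L \<Longrightarrow> set (map val z) \<subseteq> carrier G"
  using word_of_S[of z] S_carrier by (auto simp: lists_eq_set)

definition inverse_letters :: "nat list \<Rightarrow> nat list" where
  "inverse_letters z = rev (map neg z)"

lemma inverse_letters:
  assumes "z \<in> lists L"
  shows "inverse_letters z \<in> lists L" "inverse_code (list_encode z) = list_encode (inverse_letters z)"
    "list_prod (map val (inverse_letters z)) = inv (list_prod (map val z))"
proof -
  have L: "set z \<subseteq> L" using assms by (simp add: lists_eq_set)
  show "inverse_letters z \<in> lists L"
    using L neg(1) by (auto simp: inverse_letters_def lists_eq_set)
  have "map letter_neg z = map neg z" using L by (auto simp: letter_neg_def)
  then show "inverse_code (list_encode z) = list_encode (inverse_letters z)"
    unfolding inverse_code_def inverse_letters_def list_encode_inverse by (simp only:)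
  have "map val (map neg z) = map (\<lambda>x. inv x) (map val z)"
    using L neg(2) by auto
  then have "map val (inverse_letters z) = rev (map (\<lambda>x. inv x) (map val z))"
    unfolding inverse_letters_def rev_map[symmetric] by (simp only:)
  then show "list_prod (map val (inverse_letters z)) = inv (list_prod (map val z))"
    using list_prod_inverse[OF word_closed[OF assms]] by (simp only:)
qed

lemma append_code_encode: "append_code (list_encode xs) (list_encode ys) = list_encode (xs @ ys)"
  by (simp add: append_code_def)

lemma val_append:
  "y \<in> lists L \<Longrightarrow> z \<in> lists L \<Longrightarrow>
    list_prod (map val (y @ z)) = list_prod (map val y) \<otimes> list_prod (map val z)"
  by (simp only: map_append list_prod_append word_closed)

lemma val_closed: "z \<in> lists L \<Longrightarrow> list_prod (map val z) \<in> carrier G"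
  using generated by blast

lemma conjugator_test_iff:
  assumes hs: "hs \<in> lists (lists L)" and ks: "ks \<in> lists (lists L)" and g: "g \<in> lists L"
  shows "conjugator_test (list_encode g) (list_code hs) (list_code ks) \<longleftrightarrow>
    conjugate (list_prod (map val g)) (span (words_of hs)) = span (words_of ks)"
proof -
  let ?g = "list_prod (map val g)"
  note inv_g = inverse_letters[OF g]
  have letters: "ws ! n \<in> lists L" if "ws \<in> lists (lists L)" "n < length ws" for ws n
    using that nth_mem by (auto simp: in_lists_conv_set)
  have forward: "member_test (list_code ks) (append_code (list_encode g)
        (append_code (nth_default 0 (map list_encode hs) n) (inverse_code (list_encode g)))) \<longleftrightarrow>
      ?g \<otimes> list_prod (map val (hs ! n)) \<otimes> inv ?g \<in> span (words_of ks)" if n: "n < length hs" for n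
  proof -
    have h: "hs ! n \<in> lists L" by (rule letters[OF hs n])
    then have w: "g @ hs ! n @ inverse_letters g \<in> lists L" using g inv_g(1) by simp
    have "append_code (list_encode g)
        (append_code (nth_default 0 (map list_encode hs) n) (inverse_code (list_encode g))) =
        list_encode (g @ hs ! n @ inverse_letters g)"
      using n inv_g(2) by (simp add: nth_default_def append_code_encode)
    moreover have "list_prod (map val (g @ hs ! n @ inverse_letters g)) =
        ?g \<otimes> list_prod (map val (hs ! n)) \<otimes> inv ?g"
    proof -
      have "hs ! n @ inverse_letters g \<in> lists L" using h inv_g(1) by simp
      from val_append[OF g this] val_append[OF h inv_g(1)] show ?thesis
        using val_closed[OF g] val_closed[OF h] by (simp only: inv_g(3) m_assoc inv_closed)
    qed
    ultimately show ?thesis using member_test_iff[OF ks w] by (simp only:)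
  qed
  have backward: "member_test (list_code hs) (append_code (inverse_code (list_encode g))
        (append_code (nth_default 0 (map list_encode ks) n) (list_encode g))) \<longleftrightarrow>
      inv ?g \<otimes> list_prod (map val (ks ! n)) \<otimes> ?g \<in> span (words_of hs)" if n: "n < length ks" for n
  proof -
    have k: "ks ! n \<in> lists L" by (rule letters[OF ks n])
    then have w: "inverse_letters g @ ks ! n @ g \<in> lists L" using g inv_g(1) by simp
    have "append_code (inverse_code (list_encode g))
        (append_code (nth_default 0 (map list_encode ks) n) (list_encode g)) =
        list_encode (inverse_letters g @ ks ! n @ g)"
      using n inv_g(2) by (simp add: nth_default_def append_code_encode)
    moreover have "list_prod (map val (inverse_letters g @ ks ! n @ g)) =
        inv ?g \<otimes> list_prod (map val (ks ! n)) \<otimes> ?g"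
    proof -
      have "ks ! n @ g \<in> lists L" using k g by simp
      from val_append[OF inv_g(1) this] val_append[OF k g] show ?thesis
        using val_closed[OF g] val_closed[OF k] by (simp only: inv_g(3) m_assoc inv_closed)
    qed
    ultimately show ?thesis using member_test_iff[OF hs w] by (simp only:)
  qed
  have "(\<forall>w\<in>set (words_of hs). ?g \<otimes> list_prod w \<otimes> inv ?g \<in> span (words_of ks)) \<longleftrightarrow>
      (\<forall>n<length hs. ?g \<otimes> list_prod (map val (hs ! n)) \<otimes> inv ?g \<in> span (words_of ks))"
    "(\<forall>w\<in>set (words_of ks). inv ?g \<otimes> list_prod w \<otimes> ?g \<in> span (words_of hs)) \<longleftrightarrow>
      (\<forall>n<length ks. inv ?g \<otimes> list_prod (map val (ks ! n)) \<otimes> ?g \<in> span (words_of hs))"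
    by (simp_all add: all_set_conv_all_nth)
  then show ?thesis
    unfolding conjugate_span_iff[OF words_of_S[OF hs] words_of_S[OF ks] val_closed[OF g]]
      conjugator_test_def list_encode_inverse length_map
    using forward backward by (simp only: cong: conj_cong imp_cong)
qed

theorem conjugacy_test_correct:
  obtains ds where "\<And>hs ks. hs \<in> lists (lists L) \<Longrightarrow> ks \<in> lists (lists L) \<Longrightarrow>
    conjugacy_test ds (list_code hs) (list_code ks) \<longleftrightarrow>
    (\<exists>g\<in>carrier G. conjugate g (span (words_of hs)) = span (words_of ks))"
proof -
  have generators: "carrier G = list_prod ` lists S"
  proof
    show "carrier G \<subseteq> list_prod ` lists S" using generated word_of_S by blast
    show "list_prod ` lists S \<subseteq> carrier G" using S_carrier by (auto simp: lists_eq_set)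
  qed
  obtain D where D: "finite D" "D \<subseteq> carrier G"
    and bounded: "\<forall>hs ks. set hs \<subseteq> lists S \<and> hs \<noteq> [] \<longrightarrow> set ks \<subseteq> lists S \<and> ks \<noteq> [] \<longrightarrow>
      (\<exists>g\<in>carrier G. conjugate g (span hs) = span ks) \<longrightarrow>
      (\<exists>u\<in>prefix_values ks. \<exists>v\<in>prefix_values hs. \<exists>d\<in>D.
        conjugate (u \<otimes> d \<otimes> inv v) (span hs) = span ks)"
    by (rule exE[OF bounded_conjugators[OF generators finite_S]], elim conjE, rule that)
  obtain ds where ds: "ds \<in> lists (lists L)" "D = (\<lambda>z. list_prod (map val z)) ` set ds"
  proof -
    have "D \<subseteq> (\<lambda>z. list_prod (map val z)) ` lists L" using D(2) generated by simp
    then obtain Z where "Z \<subseteq> lists L" "finite Z" "D = (\<lambda>z. list_prod (map val z)) ` Z"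
      using finite_subset_image[OF D(1)] by metis
    moreover obtain ds where "set ds = Z" using finite_list \<open>finite Z\<close> by blast
    ultimately show thesis using that[of ds] by (simp add: lists_eq_set)
  qed
  show thesis
  proof (rule that[of "list_code ds"])
    fix hs ks
    assume hs: "hs \<in> lists (lists L)" and ks: "ks \<in> lists (lists L)"
    define conj where "conj w \<longleftrightarrow>
      conjugate (list_prod (map val w)) (span (words_of hs)) = span (words_of ks)" for w
    define word where "word j i m l q =
      take i (([] # ks) ! j) @ ds ! q @ inverse_letters (take l (([] # hs) ! m))" for j i m l q
    have letters: "([] # ws) ! n \<in> lists L" if "ws \<in> lists (lists L)" "n \<le> length ws" for ws n
      using that nth_mem by (cases n) (auto simp: in_lists_conv_set)
    have take_letters: "take i z \<in> lists L" if "z \<in> lists L" for i z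
      using that by (auto simp: in_lists_conv_set dest: in_set_takeD)
    have entry: "nth_default 0 (list_decode (Suc (prod_encode (0, list_code ws)))) n =
        list_encode (([] # ws) ! n)" if "n \<le> length ws" for ws n
      using that by (cases n) (auto simp: nth_default_def)
    have test: "conjugacy_test (list_code ds) (list_code hs) (list_code ks) \<longleftrightarrow>
      (\<exists>j\<le>length ks. \<exists>i\<le>length (([] # ks) ! j). \<exists>m\<le>length hs. \<exists>l\<le>length (([] # hs) ! m).
        \<exists>q<length ds. conj (word j i m l q))"
    proof -
      have "conjugator_test
          (append_code (take_code i (list_encode (([] # ks) ! j)))
            (append_code (nth_default 0 (map list_encode ds) q)
              (inverse_code (take_code l (list_encode (([] # hs) ! m))))))
          (list_code hs) (list_code ks) \<longleftrightarrow> conj (word j i m l q)"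
        if "j \<le> length ks" "m \<le> length hs" "q < length ds" for j i m l q
      proof -
        have parts: "take i (([] # ks) ! j) \<in> lists L" "take l (([] # hs) ! m) \<in> lists L" "ds ! q \<in> lists L"
          using take_letters letters[OF ks that(1)] letters[OF hs that(2)] ds(1) nth_mem[OF that(3)]
          by (auto simp: in_lists_conv_set)
        then have "word j i m l q \<in> lists L" using inverse_letters(1) unfolding word_def by simp
        moreover have "append_code (take_code i (list_encode (([] # ks) ! j)))
            (append_code (nth_default 0 (map list_encode ds) q)
              (inverse_code (take_code l (list_encode (([] # hs) ! m))))) =
            list_encode (word j i m l q)"
          unfolding word_def using that(3) inverse_letters(2)[OF parts(2)]
          by (simp add: take_code_def nth_default_def append_code_encode)
        ultimately show ?thesis
          using conjugator_test_iff[OF hs ks] unfolding conj_def by (simp only:)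
      qed
      then show ?thesis
        unfolding conjugacy_test_def list_encode_inverse length_map less_Suc_eq_le
        by (simp only: entry list_encode_inverse cong: conj_cong)
    qed
    show "conjugacy_test (list_code ds) (list_code hs) (list_code ks) \<longleftrightarrow>
      (\<exists>g\<in>carrier G. conjugate g (span (words_of hs)) = span (words_of ks))"
    proof
      assume "conjugacy_test (list_code ds) (list_code hs) (list_code ks)"
      then obtain j i m l q where jml: "j \<le> length ks" "m \<le> length hs" "q < length ds"
        and conj: "conj (word j i m l q)"
        unfolding test by blast
      have "take i (([] # ks) ! j) \<in> lists L" "take l (([] # hs) ! m) \<in> lists L" "ds ! q \<in> lists L"
        using take_letters letters[OF ks jml(1)] letters[OF hs jml(2)] ds(1) nth_mem[OF jml(3)]
        by (auto simp: in_lists_conv_set)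
      then have "word j i m l q \<in> lists L" using inverse_letters(1) unfolding word_def by simp
      then show "\<exists>g\<in>carrier G. conjugate g (span (words_of hs)) = span (words_of ks)"
        using conj val_closed unfolding conj_def by blast
    next
      assume ex: "\<exists>g\<in>carrier G. conjugate g (span (words_of hs)) = span (words_of ks)"
      let ?hs = "words_of ([] # hs)" and ?ks = "words_of ([] # ks)"
      have sub: "set ?hs \<subseteq> lists S" "set ?ks \<subseteq> lists S"
        using words_of_S[of "[] # hs"] words_of_S[of "[] # ks"] hs ks by simp_all
      have span: "span ?hs = span (words_of hs)" "span ?ks = span (words_of ks)"
        using span_Nil_Cons[OF words_of_S[OF hs]] span_Nil_Cons[OF words_of_S[OF ks]] by simp_all
      obtain u v d where u: "u \<in> prefix_values ?ks" and v: "v \<in> prefix_values ?hs" and d: "d \<in> D"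
        and eq: "conjugate (u \<otimes> d \<otimes> inv v) (span (words_of hs)) = span (words_of ks)"
        using bounded[rule_format, of ?hs ?ks] sub ex unfolding span by auto
      have prefix: "\<exists>j\<le>length ws. \<exists>i\<le>length (([] # ws) ! j). x = list_prod (map val (take i (([] # ws) ! j)))"
        if x: "x \<in> prefix_values (words_of ([] # ws))" for x ws
      proof -
        obtain w i where w: "w \<in> set (words_of ([] # ws))" "x = list_prod (take i w)"
          using x unfolding prefix_values_def by blast
        then obtain j where "j < length (words_of ([] # ws))" "w = words_of ([] # ws) ! j"
          unfolding in_set_conv_nth by blast
        then have j: "j < length ([] # ws)" "w = map val (([] # ws) ! j)"
          by (simp_all only: length_map nth_map)
        let ?i = "min i (length (([] # ws) ! j))"
        have "take i w = map val (take ?i (([] # ws) ! j))"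
          using j(2) by (simp add: take_map min_def)
        then show ?thesis using j(1) w(2)
          by (intro exI[of _ j] conjI exI[of _ ?i]) simp_all
      qed
      obtain j i where ji: "j \<le> length ks" "i \<le> length (([] # ks) ! j)"
        "u = list_prod (map val (take i (([] # ks) ! j)))"
        using prefix[OF u] by blast
      obtain m l where ml: "m \<le> length hs" "l \<le> length (([] # hs) ! m)"
        "v = list_prod (map val (take l (([] # hs) ! m)))"
        using prefix[OF v] by blast
      obtain q where q: "q < length ds" "d = list_prod (map val (ds ! q))"
        using d unfolding ds(2) by (auto simp: in_set_conv_nth)
      have parts: "take i (([] # ks) ! j) \<in> lists L" "take l (([] # hs) ! m) \<in> lists L" "ds ! q \<in> lists L"
        using take_letters letters[OF ks ji(1)] letters[OF hs ml(1)] ds(1) nth_mem[OF q(1)]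
        by (auto simp: in_lists_conv_set)
      note inverse = inverse_letters[OF parts(2)]
      have "ds ! q @ inverse_letters (take l (([] # hs) ! m)) \<in> lists L"
        using parts(3) inverse(1) by simp
      then have "list_prod (map val (word j i m l q)) = u \<otimes> (d \<otimes> inv v)"
        unfolding word_def ji(3) ml(3) q(2) inverse(3)[symmetric]
        by (simp only: val_append parts inverse(1))
      also have "\<dots> = u \<otimes> d \<otimes> inv v"
        using val_closed[OF parts(1)] val_closed[OF parts(2)] val_closed[OF parts(3)]
        unfolding ji(3) ml(3) q(2) by (simp add: m_assoc)
      finally have "conj (word j i m l q)" using eq unfolding conj_def by simp
      then show "conjugacy_test (list_code ds) (list_code hs) (list_code ks)"
        unfolding test using ji(1,2) ml(1,2) q(1) by blast
    qed
  qed
qed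

end

section \<open>Conjugacy of subgroups in amalgams of finite groups\<close>

theorem corollary5p17:
  fixes X1 X2 :: "'x set"
    and R1 R2 :: "('x word \<times> 'x word) set"
    and A :: "'a monoid"
    and Y :: "'a set"
    and \<phi>1 \<phi>2 :: "'a \<Rightarrow> 'x word set"
    and c :: "'x \<Rightarrow> nat"
  assumes "finite X1" and "finite X2" and "X1 \<inter> X2 = {}"
    and "finite R1" and "R1 \<subseteq> words X1 \<times> words X1"
    and "finite R2" and "R2 \<subseteq> words X2 \<times> words X2"
    and "finite (carrier (presented_group X1 R1))"
    and "finite (carrier (presented_group X2 R2))"
    and "group A" and "Y \<subseteq> carrier A" and "generate A Y = carrier A"
    and "\<phi>1 \<in> hom A (presented_group X1 R1)" and "inj_on \<phi>1 (carrier A)"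
    and "\<phi>2 \<in> hom A (presented_group X2 R2)" and "inj_on \<phi>2 (carrier A)"
    and "inj_on c (X1 \<union> X2)"
  shows "let X = X1 \<union> X2;
             R = amalgam_relations R1 R2 Y \<phi>1 \<phi>2;
             G = presented_group X R
         in \<exists>p. \<forall>hs \<in> lists (words X). \<forall>ks \<in> lists (words X).
              computes p [words_code c hs, words_code c ks]
                (if conjugate_subgroups G (subgroup_of_words X R hs) (subgroup_of_words X R ks)
                 then 1 else 0)"
proof -
  define R where "R = amalgam_relations R1 R2 Y \<phi>1 \<phi>2"
  have class_words: "u \<in> words Z" if "U \<in> carrier (presented_group Z Q)" "u \<in> U" for U u Z and Q :: "('x word \<times> 'x word) set"
    using that by (auto simp: presented_group_def word_class_def dest: pres_eq_words)
  interpret P: two_part_presentation X1 X2 R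
  proof
    show "X1 \<inter> X2 = {}" by fact
    fix u v assume "(u, v) \<in> R"
    then consider "(u, v) \<in> R1" | "(u, v) \<in> R2" | a where "a \<in> Y" "u \<in> \<phi>1 a" "v \<in> \<phi>2 a"
      unfolding R_def amalgam_relations_def by blast
    then show "u \<in> words X1 \<and> v \<in> words X1 \<or> u \<in> words X2 \<and> v \<in> words X2 \<or> u \<in> words X1 \<and> v \<in> words X2"
    proof cases
      case (3 a)
      then have "a \<in> carrier A" using \<open>Y \<subseteq> carrier A\<close> by blast
      then have "\<phi>1 a \<in> carrier (presented_group X1 R1)" "\<phi>2 a \<in> carrier (presented_group X2 R2)"
        using assms(13,15) by (auto simp: hom_def)
      then show ?thesis using 3 class_words by blast
    qed (use assms(5,7) in auto)
  qed
  define X where "X = X1 \<union> X2"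
  define G where "G = presented_group X R"
  let ?cls = "word_class X R"
  define letters where "letters = X \<times> (UNIV :: bool set)"
  define L where "L = letter_code c ` letters"
  define letter where "letter = inv_into letters (letter_code c)"
  define val where "val z = ?cls [letter z]" for z
  define neg where "neg z = (case letter z of (x, b) \<Rightarrow> letter_code c (x, \<not> b))" for z
  have inj: "inj_on (letter_code c) letters"
    using assms(17) by (auto simp: letters_def X_def inj_on_def letter_code_def)
  have letter: "letter (letter_code c l) = l" if "l \<in> letters" for l
    unfolding letter_def by (rule inv_into_f_f[OF inj that])
  have letter_words: "[l] \<in> words X" if "l \<in> letters" for l
    using that by (auto simp: words_def letters_def)
  have finite_S: "finite (?cls ` words X1 \<union> ?cls ` words X2)"
    using assms(8,9) by (auto intro!: finite_image_classes simp: X_def R_def amalgam_relations_def)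
  obtain label :: "'x word set \<Rightarrow> nat" where label: "inj_on label (?cls ` words X1 \<union> ?cls ` words X2)"
    using finite_imp_inj_to_nat_seg[OF finite_S] by blast
  have word_value: "P.list_prod (map val (map (letter_code c) w)) = ?cls w"
    "map (letter_code c) w \<in> lists L" if "w \<in> words X" for w
  proof -
    have w: "set w \<subseteq> letters" using that by (auto simp: words_def letters_def lists_eq_set)
    have "map val (map (letter_code c) w) = map (\<lambda>l. ?cls [l]) w"
      using w letter by (auto simp: val_def)
    then show "P.list_prod (map val (map (letter_code c) w)) = ?cls w"
      using P.list_prod_letters[of w] that unfolding X_def by (simp only:)
    show "map (letter_code c) w \<in> lists L"
      using w by (auto simp: L_def lists_eq_set)
  qed
  interpret C: coded_group "presented_group (X1 \<union> X2) R" "?cls ` words X1" "?cls ` words X2"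
    "\<lambda>U. P.crosses [] (SOME u. u \<in> U)" L val neg label
  proof (rule coded_group.intro)
    show "sided_group (presented_group (X1 \<union> X2) R) (?cls ` words X1) (?cls ` words X2)
        (\<lambda>U. P.crosses [] (SOME u. u \<in> U))"
      using P.sided_group unfolding X_def .
    show "coded_group_axioms (presented_group (X1 \<union> X2) R) (?cls ` words X1) (?cls ` words X2) L val neg label"
    proof (rule coded_group_axioms.intro)
      show "finite (?cls ` words X1 \<union> ?cls ` words X2)" by (rule finite_S)
      show "finite L" using assms(1,2) by (simp add: L_def letters_def X_def)
      show "inj_on label (?cls ` words X1 \<union> ?cls ` words X2)" by (rule label)
      fix z assume "z \<in> L"
      then obtain x b where l: "(x, b) \<in> letters" "z = letter_code c (x, b)"
        unfolding L_def by auto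
      then have l': "(x, \<not> b) \<in> letters" by (simp add: letters_def)
      have val: "val z = ?cls [(x, b)]" using letter[OF l(1)] l(2) by (simp add: val_def)
      have neg: "neg z = letter_code c (x, \<not> b)" using letter[OF l(1)] l(2) by (simp add: neg_def)
      show "val z \<in> ?cls ` words X1 \<union> ?cls ` words X2"
        unfolding val using P.letter_in_part[of "(x, b)"] l(1) by (auto simp: letters_def X_def)
      show "neg z \<in> L" unfolding neg L_def using l' by (rule imageI)
      have "val (neg z) = ?cls [(x, \<not> b)]" using letter[OF l'] by (simp add: neg val_def)
      also have "\<dots> = inv\<^bsub>presented_group (X1 \<union> X2) R\<^esub> ?cls [(x, b)]"
        using P.cls_inverse[of "[(x, b)]"] letter_words[OF l(1)] by (simp add: X_def)
      finally show "val (neg z) = inv\<^bsub>presented_group (X1 \<union> X2) R\<^esub> val z" unfolding val .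
    next
      show "carrier (presented_group (X1 \<union> X2) R) = (\<lambda>zs. P.list_prod (map val zs)) ` lists L"
      proof
        show "carrier (presented_group (X1 \<union> X2) R) \<subseteq> (\<lambda>zs. P.list_prod (map val zs)) ` lists L"
        proof
          fix U assume "U \<in> carrier (presented_group (X1 \<union> X2) R)"
          then obtain w where "w \<in> words X" "U = ?cls w"
            by (auto simp: presented_group_def X_def)
          then show "U \<in> (\<lambda>zs. P.list_prod (map val zs)) ` lists L"
            using word_value[of w] by (intro image_eqI[of _ _ "map (letter_code c) w"]) simp_all
        qed
        show "(\<lambda>zs. P.list_prod (map val zs)) ` lists L \<subseteq> carrier (presented_group (X1 \<union> X2) R)"
        proof (rule image_subsetI)
          fix zs assume "zs \<in> lists L"
          then have "set (map val zs) \<subseteq> carrier (presented_group (X1 \<union> X2) R)"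
            using letter letter_words P.cls_closed
            by (auto simp: L_def val_def X_def lists_eq_set)
          then show "P.list_prod (map val zs) \<in> carrier (presented_group (X1 \<union> X2) R)"
            by (rule P.list_prod_closed)
        qed
      qed
    qed
  qed
  obtain ds where ds: "\<And>hs ks. hs \<in> lists (lists L) \<Longrightarrow> ks \<in> lists (lists L) \<Longrightarrow>
    C.conjugacy_test ds (C.list_code hs) (C.list_code ks) \<longleftrightarrow>
    (\<exists>g\<in>carrier G. P.conjugate g (C.span (C.words_of hs)) = C.span (C.words_of ks))"
    using C.conjugacy_test_correct unfolding G_def X_def by metis
  obtain p where p: "\<And>v. length v = 2 \<Longrightarrow>
      computes p v (of_bool (C.conjugacy_test ds (arg 0 v) (arg 1 v)))"
    using recursiveD[OF C.recursive_conjugacy_test[of ds], of 2] by blast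
  have "computes p [words_code c hs, words_code c ks]
      (if conjugate_subgroups G (subgroup_of_words X R hs) (subgroup_of_words X R ks) then 1 else 0)"
    if hs: "hs \<in> lists (words X)" and ks: "ks \<in> lists (words X)" for hs ks
  proof -
    let ?codes = "map (map (letter_code c))"
    have codes: "?codes ws \<in> lists (lists L)" "words_code c ws = C.list_code (?codes ws)"
        "C.span (C.words_of (?codes ws)) = subgroup_of_words X R ws"
        "subgroup_of_words X R ws \<subseteq> carrier G"
      if ws: "ws \<in> lists (words X)" for ws
    proof -
      have w: "w \<in> words X" if "w \<in> set ws" for w using ws that by auto
      show lists: "?codes ws \<in> lists (lists L)" using word_value(2) w by (auto simp: in_lists_conv_set)
      show "words_code c ws = C.list_code (?codes ws)"
        by (simp add: words_code_def word_code_def[abs_def] comp_def)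
      have "P.list_prod ` set (C.words_of (?codes ws)) = ?cls ` set ws"
        unfolding set_map image_image using word_value(1) w by (intro image_cong) simp_all
      then show span: "C.span (C.words_of (?codes ws)) = subgroup_of_words X R ws"
        unfolding C.span_def subgroup_of_words_def X_def by simp
      show "subgroup_of_words X R ws \<subseteq> carrier G"
        using C.span_closed[OF C.words_of_S[OF lists]] unfolding span G_def X_def .
    qed
    have "conjugate_subgroups G (subgroup_of_words X R hs) (subgroup_of_words X R ks) \<longleftrightarrow>
        C.conjugacy_test ds (words_code c hs) (words_code c ks)"
      using ds[OF codes(1)[OF hs] codes(1)[OF ks]] P.conjugate_subgroups_iff codes(4)[OF hs]
      unfolding codes(2,3)[OF hs] codes(2,3)[OF ks] G_def X_def by blast
    then show ?thesis
      using p[of "[words_code c hs, words_code c ks]"] by (auto simp: of_bool_def)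
  qed
  then show ?thesis unfolding Let_def G_def X_def R_def by blast
qed

end
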